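(* Let $k$ be a field and let $G_0$ be the infinite dimensional nonunitary Grassmann algebra over $k$. If $k$ has characteristic zero, then $$CP(G_0)=\{[x_1,x_2],\ [x_1,x_2][x_3,x_4]\}^S,$$ while if $k$ has characteristic $p>2$, then $$CP(G_0)=\{[x_1,x_2],\ x_1^p,\ x_2x_1^p,\ [x_1,x_2][x_3,x_4]\}^S+\{w_n\mid n\ge 1\}^S,$$ where for each $n\ge1$, $w_n=\prod_{k=1}^n [x_{2k-1},x_{2k}]x_{2k-1}^{p-1}x_{2k}^{p-1}$.
   Context: $X=\{x_i\mid i\ge 1\}$ is a countably infinite set, and $k_0\langle X\rangle$ is the free nonunitary associative $k$-algebra over $X$. $[u,v]=uv-vu$. A $T$-space of $k_0\langle X\rangle$ is a linear subspace invariant under every endomorphism of $k_0\langle X\rangle$; for $Y\subseteq k_0\langle X\rangle$, $Y^S$ is the smallest $T$-space of $k_0\langle X\rangle$ containing $Y$. The unitary Grassmann algebra $G$ over $k$ is the unital associative algebra generated by $e_i$, $i\ge1$, with $e_ie_j=-e_je_i$ and $e_i^2=0$ for all $i,j$, and with linear basis $\{1\}\cup\mathcal B$, where $\mathcal B=\{e_{i_1}e_{i_2}\cdots e_{i_n}\mid n\ge 1,\ i_1<i_2<\cdots<i_n\}$. $G_0$ is the (nonunitary) subalgebra of $G$ with linear basis $\mathcal B$. $T(G_0)\subseteq k_0\langle X\rangle$ is the set of identities of $G_0$, i.e. the elements lying in the kernel of every homomorphism $k_0\langle X\rangle\to G_0$. A central polynomial of $G_0$ is an element $f\in k_0\langle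 X\rangle$ with $f\notin T(G_0)$ whose image under every homomorphism $k_0\langle X\rangle\to G_0$ lies in the centre of $G_0$. $CP(G_0)$ is the $T$-space of $k_0\langle X\rangle$ generated by the central polynomials of $G_0$. *)

theory Defs
  imports Complex_Main "HOL-Library.Poly_Mapping" "HOL-Library.Set_Algebras" "HOL-Computational_Algebra.Primes"
begin

section \<open>The free nonunitary associative algebra\<close>

text \<open>Words over the alphabet of natural numbers form the free monoid; it is written additively,
  so that the multiplication of the type of finitely supported functions on words is the one of
  the free unitary algebra.\<close>

instantiation list :: (type) monoid_add
begin

definition zero_list :: "'a list" where "zero_list = []"

definition plus_list :: "'a list \<Rightarrow> 'a list \<Rightarrow> 'a list" where "plus_list = (@)"

instance
  by standard (simp_all add: zero_list_def plus_list_def)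

end

type_synonym 'k free_alg = "nat list \<Rightarrow>\<^sub>0 'k"

definition fscale :: "'k::field \<Rightarrow> 'k free_alg \<Rightarrow> 'k free_alg" where
  "fscale c f = Poly_Mapping.map (\<lambda>a. c * a) f"

lemma lookup_fscale [simp]: "Poly_Mapping.lookup (fscale c f) w = c * Poly_Mapping.lookup f w"
  by (simp add: fscale_def Poly_Mapping.map.rep_eq when_def)

interpretation fa: vector_space fscale
  by unfold_locales (auto intro!: poly_mapping_eqI simp: lookup_add algebra_simps)

text \<open>The countable set of free generators is enumerated by all natural numbers: besides
  the variables with positive index there is one further variable, of index 0.\<close>

definition var :: "nat \<Rightarrow> 'k::field free_alg" where
  "var i = Poly_Mapping.single [i] 1"

definition monomial_word :: "nat list \<Rightarrow> 'k::field free_alg" where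
  "monomial_word w = prod_list (map var w)"

text \<open>The free nonunitary algebra is the span of the nonempty words inside the free unitary
  algebra.\<close>

definition free0 :: "'k::field free_alg set" where
  "free0 = fa.span (monomial_word ` {w. w \<noteq> []})"

definition comm :: "'a::ring \<Rightarrow> 'a \<Rightarrow> 'a" where
  "comm u v = u * v - v * u"

lemma monomial_word_eq: "monomial_word w = Poly_Mapping.single w 1"
  by (induction w)
     (simp_all add: monomial_word_def var_def zero_list_def plus_list_def mult_single
       flip: single_one)

lemma free0_eq: "free0 = {f :: 'k::field free_alg. Poly_Mapping.lookup f [] = 0}"
proof (intro equalityI subsetI)
  fix f :: "'k free_alg" assume "f \<in> free0"
  then show "f \<in> {f. Poly_Mapping.lookup f [] = 0}" unfolding free0_def
    by (induction rule: fa.span_induct_alt)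
       (auto simp: lookup_add monomial_word_eq lookup_single)
next
  fix f :: "'k free_alg" assume f: "f \<in> {f. Poly_Mapping.lookup f [] = 0}"
  have "f = (\<Sum>w\<in>Poly_Mapping.keys f. fscale (Poly_Mapping.lookup f w) (monomial_word w))"
    by (rule poly_mapping_eqI)
       (auto simp: lookup_sum monomial_word_eq lookup_single when_def in_keys_iff
         if_distrib[of "(*) _"] cong: if_cong)
  also have "\<dots> \<in> free0" unfolding free0_def using f
    by (intro fa.span_sum fa.span_scale fa.span_base) (auto simp: in_keys_iff)
  finally show "f \<in> free0" .
qed

section \<open>The infinite dimensional Grassmann algebra\<close>

text \<open>An element is given by its coefficients with respect to the basis of increasing products
  of generators; such a product is identified with the finite set of its indices.\<close>

typedef (overloaded) 'k grassmann =
  "{f :: nat set \<Rightarrow> 'k::field. finite {A. f A \<noteq> 0} \<and> (\<forall>A. f A \<noteq> 0 \<longrightarrow> finite A)}"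
  morphisms gcoeff Abs_grassmann
  by (rule exI[of _ "\<lambda>_. 0"]) simp

setup_lifting type_definition_grassmann

lemma gcoeff_infinite: "infinite A \<Longrightarrow> gcoeff f A = 0"
  using gcoeff[of f] by blast

lemma grassmann_eqI:
  assumes "\<And>A. finite A \<Longrightarrow> gcoeff f A = gcoeff g A"
  shows "f = g"
proof -
  have "gcoeff f A = gcoeff g A" for A
    by (cases "finite A") (simp_all add: assms gcoeff_infinite)
  then show ?thesis by (simp add: gcoeff_inject[symmetric] fun_eq_iff)
qed

text \<open>The sign arising when the product indexed by A is multiplied by the product indexed by B
  and the factors are sorted, for disjoint A and B.\<close>

definition gsign :: "nat set \<Rightarrow> nat set \<Rightarrow> 'k::field" where
  "gsign A B = (-1) ^ card {(a, b). a \<in> A \<and> b \<in> B \<and> b < a}"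

lemma gsign_empty [simp]: "gsign {} B = 1" "gsign A {} = 1"
  by (simp_all add: gsign_def)

lemma gsign_finite: "finite A \<Longrightarrow> finite B \<Longrightarrow> finite {(a, b). a \<in> A \<and> b \<in> B \<and> b < (a::nat)}"
  by (rule finite_subset[of _ "A \<times> B"]) auto

lemma gsign_union_left:
  assumes "finite A" "finite B" "finite C" "A \<inter> B = {}"
  shows "gsign (A \<union> B) C = gsign A C * gsign B C"
proof -
  have eq: "{(a, b). a \<in> A \<union> B \<and> b \<in> C \<and> b < a} =
        {(a, b). a \<in> A \<and> b \<in> C \<and> b < a} \<union> {(a, b). a \<in> B \<and> b \<in> C \<and> b < a}" by auto
  have disj: "{(a, b). a \<in> A \<and> b \<in> C \<and> b < a} \<inter> {(a, b). a \<in> B \<and> b \<in> C \<and> b < a} = {}"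
    using assms(4) by blast
  show ?thesis unfolding gsign_def eq
    card_Un_disjoint[OF gsign_finite[OF assms(1,3)] gsign_finite[OF assms(2,3)] disj]
    by (rule power_add)
qed

lemma gsign_union_right:
  assumes "finite A" "finite B" "finite C" "B \<inter> C = {}"
  shows "gsign A (B \<union> C) = gsign A B * gsign A C"
proof -
  have eq: "{(a, b). a \<in> A \<and> b \<in> B \<union> C \<and> b < a} =
        {(a, b). a \<in> A \<and> b \<in> B \<and> b < a} \<union> {(a, b). a \<in> A \<and> b \<in> C \<and> b < a}" by auto
  have disj: "{(a, b). a \<in> A \<and> b \<in> B \<and> b < a} \<inter> {(a, b). a \<in> A \<and> b \<in> C \<and> b < a} = {}"
    using assms(4) by blast
  show ?thesis unfolding gsign_def eq
    card_Un_disjoint[OF gsign_finite[OF assms(1,2)] gsign_finite[OF assms(1,3)] disj]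
    by (rule power_add)
qed

instantiation grassmann :: (field) ring_1
begin

lift_definition zero_grassmann :: "'a grassmann" is "\<lambda>_. 0" by simp

lift_definition one_grassmann :: "'a grassmann" is "\<lambda>A. if A = {} then 1 else 0" by simp

lift_definition plus_grassmann :: "'a grassmann \<Rightarrow> 'a grassmann \<Rightarrow> 'a grassmann"
  is "\<lambda>f g A. f A + g A"
proof -
  fix f g :: "nat set \<Rightarrow> 'a"
  assume "finite {A. f A \<noteq> 0} \<and> (\<forall>A. f A \<noteq> 0 \<longrightarrow> finite A)"
    "finite {A. g A \<noteq> 0} \<and> (\<forall>A. g A \<noteq> 0 \<longrightarrow> finite A)"
  moreover have "{A. f A + g A \<noteq> 0} \<subseteq> {A. f A \<noteq> 0} \<union> {A. g A \<noteq> 0}" by auto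
  ultimately show "finite {A. f A + g A \<noteq> 0} \<and> (\<forall>A. f A + g A \<noteq> 0 \<longrightarrow> finite A)"
    by (metis (no_types, lifting) add.right_neutral finite_Un finite_subset)
qed

lift_definition uminus_grassmann :: "'a grassmann \<Rightarrow> 'a grassmann" is "\<lambda>f A. - f A" by simp

definition minus_grassmann :: "'a grassmann \<Rightarrow> 'a grassmann \<Rightarrow> 'a grassmann" where
  "minus_grassmann f g = f + - g"

text \<open>Products indexed by overlapping sets vanish, so only the partitions of an index set into
  two parts contribute to its coefficient.\<close>

lift_definition times_grassmann :: "'a grassmann \<Rightarrow> 'a grassmann \<Rightarrow> 'a grassmann"
  is "\<lambda>f g S. \<Sum>A\<in>Pow S. gsign A (S - A) * f A * g (S - A)"
proof -
  fix f g :: "nat set \<Rightarrow> 'a"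
  assume f: "finite {A. f A \<noteq> 0} \<and> (\<forall>A. f A \<noteq> 0 \<longrightarrow> finite A)"
    and g: "finite {A. g A \<noteq> 0} \<and> (\<forall>A. g A \<noteq> 0 \<longrightarrow> finite A)"
  let ?h = "\<lambda>S. \<Sum>A\<in>Pow S. gsign A (S - A) * f A * g (S - A)"
  have *: "\<exists>A B. S = A \<union> B \<and> f A \<noteq> 0 \<and> g B \<noteq> 0" if S: "?h S \<noteq> 0" for S
  proof -
    obtain A where "A \<in> Pow S" "gsign A (S - A) * f A * g (S - A) \<noteq> 0"
      using sum.not_neutral_contains_not_neutral[OF S] .
    then show ?thesis by (intro exI[of _ A] exI[of _ "S - A"]) auto
  qed
  have "{S. ?h S \<noteq> 0} \<subseteq> (\<lambda>(A, B). A \<union> B) ` ({A. f A \<noteq> 0} \<times> {B. g B \<noteq> 0})"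
    using * by fastforce
  then have "finite {S. ?h S \<noteq> 0}"
    by (rule finite_subset) (use f g in auto)
  moreover have "finite S" if "?h S \<noteq> 0" for S
    using *[OF that] f g by blast
  ultimately show "finite {S. ?h S \<noteq> 0} \<and> (\<forall>S. ?h S \<noteq> 0 \<longrightarrow> finite S)" by blast
qed

lemma grassmann_assoc: "f * g * h = f * (g * h)" for f g h :: "'a grassmann"
proof (rule grassmann_eqI)
  fix S :: "nat set" assume S: "finite S"
  define F where "F A B = gsign A B * gsign A (S - A - B) * gsign B (S - A - B)
      * gcoeff f A * gcoeff g B * gcoeff h (S - A - B)" for A B
  have fin: "finite A" if "A \<subseteq> S" for A using that S finite_subset by blast
  have "gcoeff (f * g * h) S = (\<Sum>D\<in>Pow S. gsign D (S - D) *
      (\<Sum>A\<in>Pow D. gsign A (D - A) * gcoeff f A * gcoeff g (D - A)) * gcoeff h (S - D))"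
    by (simp add: times_grassmann.rep_eq)
  also have "\<dots> = (\<Sum>D\<in>Pow S. \<Sum>A\<in>Pow D. F A (D - A))"
  proof (intro sum.cong refl, unfold sum_distrib_left sum_distrib_right, intro sum.cong refl)
    fix D A assume D: "D \<in> Pow S" and A: "A \<in> Pow D"
    have "S - A - (D - A) = S - D" using A by auto
    moreover have "gsign D (S - D) = (gsign A (S - D) * gsign (D - A) (S - D) :: 'a)"
      using gsign_union_left[of A "D - A" "S - D"] D A
      by (simp add: fin subset_trans[of A D S] Un_absorb1 Diff_subset subset_trans[of "D - A" D S])
    ultimately show "gsign D (S - D) * (gsign A (D - A) * gcoeff f A * gcoeff g (D - A))
        * gcoeff h (S - D) = F A (D - A)"
      by (simp add: F_def mult_ac)
  qed
  also have "\<dots> = (\<Sum>(D, A)\<in>Sigma (Pow S) Pow. F A (D - A))"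
    using S fin by (subst sum.Sigma) auto
  also have "\<dots> = (\<Sum>(A, B)\<in>Sigma (Pow S) (\<lambda>A. Pow (S - A)). F A B)"
    by (rule sum.reindex_bij_witness[of _ "\<lambda>(A, B). (A \<union> B, A)" "\<lambda>(D, A). (A, D - A)"])
       (auto simp: F_def)
  also have "\<dots> = (\<Sum>A\<in>Pow S. \<Sum>B\<in>Pow (S - A). F A B)"
    using S fin by (subst sum.Sigma) auto
  also have "\<dots> = (\<Sum>A\<in>Pow S. gsign A (S - A) * gcoeff f A *
      (\<Sum>B\<in>Pow (S - A). gsign B (S - A - B) * gcoeff g B * gcoeff h (S - A - B)))"
  proof (intro sum.cong refl, unfold sum_distrib_left, intro sum.cong refl)
    fix A B assume A: "A \<in> Pow S" and B: "B \<in> Pow (S - A)"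
    have "B \<union> (S - A - B) = S - A" using B by auto
    then have "gsign A (S - A) = (gsign A B * gsign A (S - A - B) :: 'a)"
      using gsign_union_right[of A B "S - A - B"] A B fin[of A] fin[of B] S
      by (auto simp: subset_trans[of B "S - A" S])
    then show "F A B = gsign A (S - A) * gcoeff f A *
        (gsign B (S - A - B) * gcoeff g B * gcoeff h (S - A - B))"
      by (simp add: F_def mult_ac)
  qed
  also have "\<dots> = gcoeff (f * (g * h)) S"
    by (simp add: times_grassmann.rep_eq)
  finally show "gcoeff (f * g * h) S = gcoeff (f * (g * h)) S" .
qed

instance
proof
  fix f g h :: "'a grassmann"
  show "f * g * h = f * (g * h)" by (rule grassmann_assoc)
  show "1 * f = f"
  proof (rule grassmann_eqI)
    fix S :: "nat set" assume S: "finite S"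
    have "gcoeff (1 * f) S = (\<Sum>A\<in>Pow S. if A = {} then gcoeff f S else 0)"
      unfolding times_grassmann.rep_eq one_grassmann.rep_eq by (intro sum.cong) auto
    then show "gcoeff (1 * f) S = gcoeff f S" using S by simp
  qed
  show "f * 1 = f"
  proof (rule grassmann_eqI)
    fix S :: "nat set" assume S: "finite S"
    have "gcoeff (f * 1) S = (\<Sum>A\<in>Pow S. if A = S then gcoeff f S else 0)"
      unfolding times_grassmann.rep_eq one_grassmann.rep_eq by (intro sum.cong) auto
    then show "gcoeff (f * 1) S = gcoeff f S" using S by simp
  qed
  show "(f + g) * h = f * h + g * h" "f * (g + h) = f * g + f * h"
    by (rule grassmann_eqI;
        simp add: times_grassmann.rep_eq plus_grassmann.rep_eq algebra_simps sum.distrib)+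
  show "f + g + h = f + (g + h)" "f + g = g + f" "0 + f = f" "- f + f = 0"
    by (transfer; simp add: algebra_simps fun_eq_iff)+
  show "f - g = f + - g" by (rule minus_grassmann_def)
  show "(0 :: 'a grassmann) \<noteq> 1" by transfer (auto simp: fun_eq_iff)
qed

end

lift_definition gscale :: "'k::field \<Rightarrow> 'k grassmann \<Rightarrow> 'k grassmann" is "\<lambda>c f A. c * f A"
  by simp

interpretation gr: vector_space gscale
  by unfold_locales (transfer; simp add: algebra_simps fun_eq_iff)+

lemma gscale_mult: "gscale c f * g = gscale c (f * g)" "f * gscale c g = gscale c (f * g)"
  by (rule grassmann_eqI; simp add: times_grassmann.rep_eq gscale.rep_eq sum_distrib_left mult_ac)+

lift_definition gbasis :: "nat set \<Rightarrow> 'k::field grassmann"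
  is "\<lambda>A B. if finite A \<and> B = A then 1 else 0"
  by (auto intro: finite_subset[of _ "{A}" for A])

definition egen :: "nat \<Rightarrow> 'k::field grassmann" where
  "egen i = gbasis {i}"

text \<open>The following facts are the defining relations of the Grassmann algebra, and that the
  increasing products of generators, together with the empty product, form a linear basis.\<close>

lemma gbasis_mult:
  assumes "finite A" "finite B"
  shows "gbasis A * gbasis B = (if A \<inter> B = {} then gscale (gsign A B) (gbasis (A \<union> B)) else 0)"
proof (rule grassmann_eqI)
  fix S :: "nat set" assume S: "finite S"
  have "gcoeff (gbasis A * gbasis B) S =
      (\<Sum>C\<in>Pow S. if C = A then (if S - A = B then gsign A B else 0) else (0::'a))"
    unfolding times_grassmann.rep_eq gbasis.rep_eq using assms by (intro sum.cong) auto
  also have "\<dots> = (if A \<subseteq> S \<and> S - A = B then gsign A B else 0)"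
    using S by simp
  also have "(A \<subseteq> S \<and> S - A = B) \<longleftrightarrow> A \<inter> B = {} \<and> S = A \<union> B" by auto
  finally show "gcoeff (gbasis A * gbasis B) S =
      gcoeff (if A \<inter> B = {} then gscale (gsign A B) (gbasis (A \<union> B)) else (0::'a grassmann)) S"
    using assms by (simp add: gscale.rep_eq gbasis.rep_eq zero_grassmann.rep_eq)
qed

lemma egen_square: "egen i * egen i = 0"
  by (simp add: egen_def gbasis_mult)

lemma egen_anticommute: "egen i * egen j = - (egen j * egen i)"
proof (cases "i = j")
  case True
  then show ?thesis by (simp add: egen_square)
next
  case False
  have *: "{(a, b). a = i \<and> b = j \<and> b < a} = (if j < i then {(i, j)} else {})" for i j :: nat
    by auto
  have "gsign {i} {j} = (- gsign {j} {i} :: 'a)"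
    using False by (auto simp: gsign_def *)
  with False show ?thesis
    by (simp add: egen_def gbasis_mult insert_commute gr.scale_minus_left)
qed

lemma prod_list_egen:
  "sorted_wrt (<) is \<Longrightarrow> prod_list (map egen is) = gbasis (set is)"
proof (induction "is")
  case Nil
  show ?case by (simp, transfer) auto
next
  case (Cons i "is")
  then have *: "{(a, b). a \<in> {i} \<and> b \<in> set is \<and> b < a} = {}" by auto
  have "gsign {i} (set is) = (1::'a)" unfolding gsign_def * by simp
  with Cons show ?case by (auto simp: egen_def gbasis_mult)
qed

lemma gbasis_expansion: "f = (\<Sum>A\<in>{A. gcoeff f A \<noteq> 0}. gscale (gcoeff f A) (gbasis A))"
proof -
  have fin: "finite {A. gcoeff f A \<noteq> 0}" "\<And>A. gcoeff f A \<noteq> 0 \<Longrightarrow> finite A"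
    using gcoeff[of f] by auto
  have [simp]: "gcoeff (sum h I) A = (\<Sum>i\<in>I. gcoeff (h i) A)"
    for h :: "nat set \<Rightarrow> 'a grassmann" and I A
    by (induction I rule: infinite_finite_induct)
       (simp_all add: zero_grassmann.rep_eq plus_grassmann.rep_eq)
  show ?thesis
  proof (rule grassmann_eqI)
    fix S :: "nat set" assume "finite S"
    have "(\<Sum>A\<in>{A. gcoeff f A \<noteq> 0}. gcoeff f A * gcoeff (gbasis A) S) =
        (\<Sum>A\<in>{A. gcoeff f A \<noteq> 0}. if A = S then gcoeff f S else 0)"
      using fin by (intro sum.cong) (auto simp: gbasis.rep_eq)
    then show "gcoeff f S = gcoeff (\<Sum>A\<in>{A. gcoeff f A \<noteq> 0}. gscale (gcoeff f A) (gbasis A)) S"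
      using fin by (simp add: gscale.rep_eq)
  qed
qed

text \<open>The nonunitary Grassmann algebra, spanned by the nonempty increasing products.\<close>

definition grass0_basis :: "'k::field grassmann set" where
  "grass0_basis = {prod_list (map egen is) | is. is \<noteq> [] \<and> sorted_wrt (<) is}"

definition grass0 :: "'k::field grassmann set" where
  "grass0 = gr.span grass0_basis"

lemma grass0_eq: "grass0 = {f :: 'k::field grassmann. gcoeff f {} = 0}"
proof (intro equalityI subsetI)
  fix f :: "'k grassmann" assume "f \<in> grass0"
  then show "f \<in> {f. gcoeff f {} = 0}" unfolding grass0_def
    by (induction rule: gr.span_induct_alt)
       (auto simp: grass0_basis_def prod_list_egen gbasis.rep_eq zero_grassmann.rep_eq
         plus_grassmann.rep_eq gscale.rep_eq)
next
  fix f :: "'k grassmann" assume f: "f \<in> {f. gcoeff f {} = 0}"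
  have "gbasis A \<in> (grass0_basis :: 'k grassmann set)" if "gcoeff f A \<noteq> 0" for A
  proof -
    have "finite A" using that gcoeff[of f] by auto
    moreover have "A \<noteq> {}" using that f by auto
    ultimately show ?thesis unfolding grass0_basis_def
      by (intro CollectI exI[of _ "sorted_list_of_set A"])
         (simp add: prod_list_egen strict_sorted_list_of_set)
  qed
  then have "(\<Sum>A\<in>{A. gcoeff f A \<noteq> 0}. gscale (gcoeff f A) (gbasis A)) \<in> grass0"
    unfolding grass0_def by (intro gr.span_sum gr.span_scale gr.span_base) auto
  then show "f \<in> grass0" using gbasis_expansion[of f] by simp
qed

section \<open>T-spaces, identities and central polynomials\<close>

text \<open>Homomorphisms of (not necessarily unitary) algebras between subalgebras A and B;
  only the values on A matter.\<close>

definition alg_hom_on ::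
  "('k \<Rightarrow> 'a \<Rightarrow> 'a) \<Rightarrow> 'a::ring set \<Rightarrow> ('k \<Rightarrow> 'b \<Rightarrow> 'b) \<Rightarrow> 'b::ring set \<Rightarrow> ('a \<Rightarrow> 'b) \<Rightarrow> bool" where
  "alg_hom_on sA A sB B \<phi> \<longleftrightarrow>
     (\<forall>u\<in>A. \<phi> u \<in> B) \<and>
     (\<forall>u\<in>A. \<forall>v\<in>A. \<phi> (u + v) = \<phi> u + \<phi> v) \<and>
     (\<forall>u\<in>A. \<forall>v\<in>A. \<phi> (u * v) = \<phi> u * \<phi> v) \<and>
     (\<forall>c. \<forall>u\<in>A. \<phi> (sA c u) = sB c (\<phi> u))"

definition T_space :: "'k::field free_alg set \<Rightarrow> bool" where
  "T_space V \<longleftrightarrow> V \<subseteq> free0 \<and> fa.subspace V \<and>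
     (\<forall>\<phi>. alg_hom_on fscale free0 fscale free0 \<phi> \<longrightarrow> \<phi> ` V \<subseteq> V)"

definition T_span :: "'k::field free_alg set \<Rightarrow> 'k free_alg set" where
  "T_span Y = T_space hull Y"

text \<open>The hull of a subset of the free nonunitary algebra is itself a T-space, hence the smallest
  one containing the subset.\<close>

lemma T_space_T_span:
  fixes Y :: "'k::field free_alg set"
  assumes "Y \<subseteq> free0"
  shows "T_space (T_span Y)"
proof -
  have "T_space (free0 :: 'k free_alg set)"
    by (auto simp: T_space_def alg_hom_on_def free0_def)
  with assms have sub: "T_span Y \<subseteq> free0"
    unfolding T_span_def by (rule hull_minimal)
  have "fa.subspace (T_span Y)"
    unfolding T_span_def hull_def by (intro fa.subspace_Inter) (auto simp: T_space_def)
  moreover have "\<phi> ` T_span Y \<subseteq> T_span Y" if "alg_hom_on fscale free0 fscale free0 \<phi>" for \<phi>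
    using that unfolding T_span_def hull_def by (auto simp: T_space_def) blast
  ultimately show ?thesis using sub by (simp add: T_space_def)
qed

definition grass0_identities :: "'k::field free_alg set" where
  "grass0_identities =
     {f \<in> free0. \<forall>\<phi>. alg_hom_on fscale free0 gscale grass0 \<phi> \<longrightarrow> \<phi> f = 0}"

definition grass0_centre :: "'k::field grassmann set" where
  "grass0_centre = {z \<in> grass0. \<forall>g\<in>grass0. z * g = g * z}"

definition grass0_central_polys :: "'k::field free_alg set" where
  "grass0_central_polys =
     {f \<in> free0. f \<notin> grass0_identities \<and>
        (\<forall>\<phi>. alg_hom_on fscale free0 gscale grass0 \<phi> \<longrightarrow> \<phi> f \<in> grass0_centre)}"

definition CP_grass0 :: "'k::field free_alg set" where
  "CP_grass0 = T_span grass0_central_polys"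

definition w_poly :: "nat \<Rightarrow> nat \<Rightarrow> 'k::field free_alg" where
  "w_poly p n = prod_list (map (\<lambda>k. comm (var (2*k-1)) (var (2*k)) * var (2*k-1) ^ (p-1) * var (2*k) ^ (p-1))
                       [1..<n+1])"

end

theory Submission
  imports Defs "HOL-Library.Nat_Bijection"
begin

text \<open>Substitute generic elements a(i) + u(i) for the variables, with a(i) even and u(i) odd.
  Writing u(i) = da(i), the value of a polynomial has the form omega + d omega, where omega is an
  even differential form over the polynomial algebra in the a(i), truncated by a(i)^p = 0 in
  characteristic p. The centre of the Grassmann algebra is its even part, so the polynomial is
  central or an identity if and only if omega is closed. A product of commutators
  [P, x(1)] [x(2), x(3)] ... corresponds, up to a power of 2, to the exact form dP dx(1) dx(2) ...,
  and the Poincare lemma, applied in each multidegree to the first variable whose degree is not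
  divisible by p, shows that closed forms are exact up to products of the forms a(i)^(p-1) da(i),
  which come from the w(n). The identities are harmless because
  [[a,b],c] v = [a,b] [c,v] - [c, [a,b] v] puts the T-ideal generated by the triple commutators
  into the T-space.\<close>

section \<open>Evaluation of polynomials\<close>

text \<open>Forms are never formalised. Instead a complement of the T-space is fixed: the span of
  the monomials \<open>mon (w, js)\<close> with \<open>(w, js)\<close> in \<open>std_pairs\<close>,
  which stand for the forms w d(js) lacking the differential of the pivot variable. The homotopy
  rewrites all other monomials modulo the T-space, so the T-space and the standard monomials
  together span \<open>free0\<close>. Conversely d is injective on the standard span: along the
  pivot i, the derivative of w has coefficient \<open>count (mset w) i\<close>, which is nonzero in
  k, and multidegree and pivot determine the monomial. So a polynomial with central values has no
  standard part. A nonzero multidegree without pivot is divisible by p in every variable. Once p-th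
  powers are gone, only products of a^(p-1) da remain there; they are closed but not exact, which is
  why the \<open>w_n\<close> are needed. The p-th powers vanish on G_0 because it has no constant
  terms. The obstacle is that letters of a word do not commute: each exchange creates a further
  commutator. The total degree does not drop, but the word part gets shorter, hence the induction on
  its length.\<close>

text \<open>Adjacent transpositions generate all permutations. \<open>P\<close> is an arbitrary
  reflexive and transitive relation, so that one rule serves equality of products, equality up to
  sign modulo an ideal, and equivalence of memberships.\<close>

lemma prod_list_swap_induct:
  assumes refl: "\<And>xs. P xs xs"
    and trans: "\<And>xs ys zs. P xs ys \<Longrightarrow> P ys zs \<Longrightarrow> P xs zs"
    and swap: "\<And>us a b vs. P (us @ a # b # vs) (us @ b # a # vs)"
    and "mset xs = mset ys"
  shows "P xs ys"
proof -
  have move: "P (zs @ x # us @ vs) (zs @ us @ x # vs)" for zs x us vs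
  proof (induction us arbitrary: zs)
    case Nil
    show ?case by (simp add: refl)
  next
    case (Cons u us)
    have "P (zs @ x # u # us @ vs) ((zs @ [u]) @ x # us @ vs)"
      using swap[of zs x u] by simp
    then show ?case using Cons[of "zs @ [u]"] by (auto intro: trans)
  qed
  have "P (zs @ xs) (zs @ ys)" if "mset xs = mset ys" for zs
    using that
  proof (induction xs arbitrary: zs ys)
    case Nil
    then show ?case by (simp add: refl)
  next
    case (Cons x xs)
    then have "x \<in> set ys" by (metis list.set_intros(1) set_mset_mset)
    then obtain us vs where ys: "ys = us @ x # vs" by (meson split_list)
    with Cons.prems have "mset xs = mset (us @ vs)" by simp
    then have "P ((zs @ [x]) @ xs) ((zs @ [x]) @ us @ vs)" by (rule Cons.IH)
    with move[of zs x us vs] show ?case by (auto simp: ys intro: trans)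
  qed
  from this[of "[]"] assms(4) show ?thesis by simp
qed

lemma monomial_word_simps [simp]:
  "monomial_word [] = 1" "monomial_word (x # w) = var x * monomial_word w"
  "monomial_word (u @ w) = monomial_word u * monomial_word w"
  "monomial_word (replicate n x) = var x ^ n"
  by (simp_all add: monomial_word_def)

lemma fscale_eq_mult: "fscale c f = Poly_Mapping.single [] c * f"
  using mult_map_scale_conv_mult[of c f] by (simp add: fscale_def zero_list_def)

lemma free_alg_expansion:
  "f = (\<Sum>w\<in>Poly_Mapping.keys f. fscale (Poly_Mapping.lookup f w) (monomial_word w))"
  by (rule poly_mapping_eqI)
     (auto simp: lookup_sum monomial_word_eq lookup_single when_def in_keys_iff
        if_distrib[of "(*) _"] cong: if_cong)

lemma free_alg_induct [case_names zero step]: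
  assumes "P 0" and "\<And>c w f. P f \<Longrightarrow> P (fscale c (monomial_word w) + f)"
  shows "P f"
proof -
  have "f \<in> fa.span (range monomial_word)"
    by (subst free_alg_expansion) (intro fa.span_sum fa.span_scale fa.span_base rangeI)
  then show ?thesis
    by (induction rule: fa.span_induct_alt) (auto intro: assms)
qed

lemma fscale_mult_left: "fscale c f * g = fscale c (f * g)"
  by (simp add: fscale_eq_mult mult.assoc)

lemma fscale_mult_right: "f * fscale c g = fscale c (f * g)"
proof -
  have "f * Poly_Mapping.single [] c = Poly_Mapping.single [] c * f"
    by (induction f rule: free_alg_induct)
       (simp_all add: algebra_simps fscale_mult_left monomial_word_eq mult_single plus_list_def
          fscale_eq_mult)
  then show ?thesis by (simp add: fscale_eq_mult flip: mult.assoc)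
qed

lemma free0_ideal: "u * f * v \<in> free0" if "f \<in> free0"
proof -
  have 1: "u * f \<in> free0" if "f \<in> free0" for u f :: "'k::field free_alg"
    using that unfolding free0_def
  proof (induction rule: fa.span_induct_alt)
    case base
    then show ?case by (simp add: fa.span_zero)
  next
    case (step c x y)
    have "u * x \<in> fa.span (monomial_word ` {w. w \<noteq> []})"
    proof (induction u rule: free_alg_induct)
      case zero
      then show ?case by (simp add: fa.span_zero)
    next
      case (step c w f)
      from \<open>x \<in> _\<close> obtain v where "x = monomial_word v" "v \<noteq> []" by auto
      then have "monomial_word w * x \<in> fa.span (monomial_word ` {w. w \<noteq> []})"
        by (intro fa.span_base image_eqI[of _ _ "w @ v"]) auto
      with step show ?case
        by (simp add: distrib_right fscale_mult_left fa.span_add fa.span_scale)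
    qed
    with step show ?case
      by (simp add: distrib_left fscale_mult_right fa.span_add fa.span_scale)
  qed
  have 2: "f * v \<in> free0" if "f \<in> free0" for v f :: "'k::field free_alg"
    using that unfolding free0_def
  proof (induction rule: fa.span_induct_alt)
    case base
    then show ?case by (simp add: fa.span_zero)
  next
    case (step c x y)
    have "x * v \<in> fa.span (monomial_word ` {w. w \<noteq> []})"
    proof (induction v rule: free_alg_induct)
      case zero
      then show ?case by (simp add: fa.span_zero)
    next
      case (step c w f)
      from \<open>x \<in> _\<close> obtain v where "x = monomial_word v" "v \<noteq> []" by auto
      then have "x * monomial_word w \<in> fa.span (monomial_word ` {w. w \<noteq> []})"
        by (intro fa.span_base image_eqI[of _ _ "v @ w"]) auto
      with step show ?case
        by (simp add: distrib_left fscale_mult_right fa.span_add fa.span_scale)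
    qed
    with step show ?case
      by (simp add: distrib_right fscale_mult_left fa.span_add fa.span_scale)
  qed
  show ?thesis using that by (intro 1 2)
qed

lemma free0_mult_left: "f \<in> free0 \<Longrightarrow> u * f \<in> free0"
  using free0_ideal[of f u 1] by simp

lemma free0_mult_right: "f \<in> free0 \<Longrightarrow> f * v \<in> free0"
  using free0_ideal[of f 1 v] by simp

lemma subspace_free0: "fa.subspace free0"
  by (simp add: free0_def)

lemma var_in_free0 [simp]: "var i \<in> free0"
  by (simp add: free0_eq var_def lookup_single)

lemma comm_var_in_free0 [simp]: "comm (var i) (var j) \<in> free0"
  by (simp add: comm_def subspace_free0 fa.subspace_diff free0_mult_left)

text \<open>T-spaces allow only substitutions from \<open>free0\<close>. Commutators do not see
  constant terms, so splitting these off extends the closure properties to arguments from the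
  unitary algebra.\<close>

lemma free0_const_decomp:
  obtains c g where "g \<in> free0" "f = fscale c 1 + g"
proof
  let ?c = "Poly_Mapping.lookup f []"
  show "f - fscale ?c 1 \<in> free0"
    by (simp add: free0_eq lookup_minus lookup_one zero_list_def)
qed simp

section \<open>Substitution into noncommutative polynomials\<close>

locale unital_algebra = vector_space sc for sc :: "'k::field \<Rightarrow> 'b::ring_1 \<Rightarrow> 'b" +
  assumes scale_mult: "sc c x * y = sc c (x * y)" "x * sc c y = sc c (x * y)"
begin

definition evalp :: "(nat \<Rightarrow> 'b) \<Rightarrow> 'k free_alg \<Rightarrow> 'b" where
  "evalp y f = (\<Sum>w\<in>Poly_Mapping.keys f. sc (Poly_Mapping.lookup f w) (prod_list (map y w)))"

lemma evalp_superset: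
  "finite K \<Longrightarrow> Poly_Mapping.keys f \<subseteq> K \<Longrightarrow>
    evalp y f = (\<Sum>w\<in>K. sc (Poly_Mapping.lookup f w) (prod_list (map y w)))"
  unfolding evalp_def by (intro sum.mono_neutral_left) (auto simp: in_keys_iff)

lemma evalp_add: "evalp y (f + g) = evalp y f + evalp y g"
proof -
  let ?K = "Poly_Mapping.keys f \<union> Poly_Mapping.keys g"
  have "Poly_Mapping.keys (f + g) \<subseteq> ?K" by (rule keys_add)
  then show ?thesis
    by (simp add: evalp_superset[of ?K] lookup_add scale_left_distrib sum.distrib)
qed

lemma evalp_zero [simp]: "evalp y 0 = 0"
  by (simp add: evalp_def)

lemma evalp_scale: "evalp y (fscale c f) = sc c (evalp y f)"
proof -
  have "Poly_Mapping.keys (fscale c f) \<subseteq> Poly_Mapping.keys f" by (auto simp: in_keys_iff)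
  then show ?thesis
    by (simp add: evalp_superset[of "Poly_Mapping.keys f"] scale_sum_right)
qed

lemma evalp_diff: "evalp y (f - g) = evalp y f - evalp y g"
  using evalp_add[of y "f - g" g] by simp

lemma evalp_sum: "evalp y (sum h K) = (\<Sum>i\<in>K. evalp y (h i))"
  by (induction K rule: infinite_finite_induct) (simp_all add: evalp_add)

lemma evalp_word [simp]: "evalp y (monomial_word w) = prod_list (map y w)"
  unfolding monomial_word_eq by (subst evalp_superset[of "{w}"]) auto

lemma evalp_one [simp]: "evalp y 1 = 1"
  using evalp_word[of y "[]"] by simp

lemma evalp_var [simp]: "evalp y (var i) = y i"
  using evalp_word[of y "[i]"] by simp

lemma evalp_mult: "evalp y (f * g) = evalp y f * evalp y g"
proof (induction f rule: free_alg_induct)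
  case (step c w f)
  have "evalp y (monomial_word w * g) = prod_list (map y w) * evalp y g"
  proof (induction g rule: free_alg_induct)
    case (step c v g)
    have "evalp y (monomial_word w * monomial_word v) = prod_list (map y w) * prod_list (map y v)"
      using evalp_word[of y "w @ v"] by simp
    with step show ?case
      by (simp add: distrib_left evalp_add fscale_mult_right evalp_scale scale_mult)
  qed simp
  with step show ?case
    by (simp add: distrib_right evalp_add fscale_mult_left evalp_scale scale_mult)
qed simp

lemma evalp_comm: "evalp y (comm f g) = comm (evalp y f) (evalp y g)"
  by (simp add: comm_def evalp_mult evalp_diff)

lemma evalp_power: "evalp y (f ^ n) = evalp y f ^ n"
  by (induction n) (simp_all add: evalp_mult)

lemma evalp_prod_list: "evalp y (prod_list fs) = prod_list (map (evalp y) fs)"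
  by (induction fs) (simp_all add: evalp_mult)

text \<open>The source of all explicit homomorphisms below: endomorphisms of \<open>free0\<close>,
  under which T-spaces are closed, and evaluations in \<open>grass0\<close>.\<close>

lemma alg_hom_on_evalp:
  assumes "subspace B" and "\<And>u v. u \<in> B \<Longrightarrow> v \<in> B \<Longrightarrow> u * v \<in> B" and y: "\<And>i. y i \<in> B"
  shows "alg_hom_on fscale free0 sc B (evalp y)"
proof -
  have word: "prod_list (map y w) \<in> B" if "w \<noteq> []" for w
    using that
  proof (induction w)
    case (Cons x w)
    then show ?case using assms(2)[OF y] y by (cases "w = []") auto
  qed simp
  have "evalp y f \<in> B" if "f \<in> free0" for f
    using that unfolding free0_def
    by (induction rule: fa.span_induct_alt)
       (auto simp: evalp_add evalp_scale word assms(1) subspace_0 subspace_add subspace_scale)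
  then show ?thesis
    by (simp add: alg_hom_on_def evalp_add evalp_mult evalp_scale)
qed

end

interpretation fau: unital_algebra fscale
  by unfold_locales (simp_all add: fscale_mult_left fscale_mult_right)

lemma T_space_evalp:
  assumes "T_space V" "f \<in> V" "\<And>i. y i \<in> free0"
  shows "fau.evalp y f \<in> V"
proof -
  have "alg_hom_on fscale free0 fscale free0 (fau.evalp y)"
    using assms(3) by (intro fau.alg_hom_on_evalp subspace_free0 free0_mult_left)
  with assms(1,2) show ?thesis unfolding T_space_def by blast
qed

lemma alg_hom_on_compose:
  "alg_hom_on sA A sB B \<phi> \<Longrightarrow> alg_hom_on sB B sC C \<psi> \<Longrightarrow> alg_hom_on sA A sC C (\<lambda>x. \<psi> (\<phi> x))"
  by (simp add: alg_hom_on_def)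

section \<open>Parity in the Grassmann algebra\<close>

interpretation gru: unital_algebra gscale
  by unfold_locales (simp_all add: gscale_mult)

lemmas gcoeff_simps = zero_grassmann.rep_eq plus_grassmann.rep_eq uminus_grassmann.rep_eq
  gscale.rep_eq gbasis.rep_eq

lemma gcoeff_diff: "gcoeff (f - g) A = gcoeff f A - gcoeff g A"
  unfolding minus_grassmann_def plus_grassmann.rep_eq uminus_grassmann.rep_eq by simp

lemma gcoeff_sum: "gcoeff (sum h I) A = (\<Sum>i\<in>I. gcoeff (h i) A)"
  by (induction I rule: infinite_finite_induct) (simp_all add: gcoeff_simps)

text \<open>By disjointness every pair in \<open>A \<times> B\<close> is an inversion for exactly
  one of the two orders, so the two inversion counts add up to
  \<open>card A * card B\<close>.\<close>

lemma gsign_commute: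
  assumes "finite A" "finite B" "A \<inter> B = {}"
  shows "gsign A B = (-1) ^ (card A * card B) * gsign B A"
proof -
  let ?S = "{(a, b). a \<in> A \<and> b \<in> B \<and> b < a}" and ?T = "{(b, a). b \<in> B \<and> a \<in> A \<and> a < b}"
  have "A \<times> B = ?S \<union> prod.swap ` ?T"
  proof (intro equalityI subsetI)
    fix x assume "x \<in> A \<times> B"
    then obtain a b where x: "x = (a, b)" "a \<in> A" "b \<in> B" by auto
    with assms(3) have "a \<noteq> b" by auto
    then consider "b < a" | "a < b" by linarith
    then show "x \<in> ?S \<union> prod.swap ` ?T"
      using x by cases (auto simp: image_iff)
  qed auto
  moreover have "?S \<inter> prod.swap ` ?T = {}" by auto
  ultimately have "card (A \<times> B) = card ?S + card (prod.swap ` ?T)"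
    using gsign_finite[OF assms(1,2)] gsign_finite[OF assms(2,1)]
    by (simp add: card_Un_disjoint)
  then have "card A * card B = card ?S + card ?T"
    by (simp add: card_image card_cartesian_product)
  then have "(-1) ^ (card A * card B) * gsign B A =
      ((-1) ^ card ?S * ((-1) ^ card ?T * (-1) ^ card ?T) :: 'a)"
    by (simp add: gsign_def power_add)
  also have "(-1) ^ card ?T * (-1) ^ card ?T = (1 :: 'a)"
    by (simp flip: power_add mult_2)
  finally show ?thesis by (simp add: gsign_def)
qed

text \<open>An infinite index set has \<open>card\<close> 0, but its coefficient is 0 as well, so it
  disturbs neither parity.\<close>

definition geven :: "'k::field grassmann \<Rightarrow> bool" where
  "geven f \<longleftrightarrow> (\<forall>A. odd (card A) \<longrightarrow> gcoeff f A = 0)"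

definition godd :: "'k::field grassmann \<Rightarrow> bool" where
  "godd f \<longleftrightarrow> (\<forall>A. even (card A) \<longrightarrow> gcoeff f A = 0)"

lemma geven_simps [simp]:
  "geven 0" "geven f \<Longrightarrow> geven g \<Longrightarrow> geven (f + g)" "geven f \<Longrightarrow> geven (gscale c f)"
  "geven 1"
  by (auto simp: geven_def gcoeff_simps one_grassmann.rep_eq)

lemma godd_simps [simp]:
  "godd 0" "godd f \<Longrightarrow> godd g \<Longrightarrow> godd (f + g)" "godd f \<Longrightarrow> godd (gscale c f)"
  by (auto simp: godd_def gcoeff_simps)

lemma geven_gbasis: "even (card A) \<Longrightarrow> geven (gbasis A)"
  by (auto simp: geven_def gcoeff_simps)

lemma godd_gbasis: "odd (card A) \<Longrightarrow> godd (gbasis A)"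
  by (auto simp: godd_def gcoeff_simps)

lemma gcoeff_mult_nonzeroE:
  assumes "gcoeff (f * g) S \<noteq> 0"
  obtains A where "finite S" "A \<subseteq> S" "gcoeff f A \<noteq> 0" "gcoeff g (S - A) \<noteq> 0"
    "card S = card A + card (S - A)"
proof -
  have fin: "finite S" using assms gcoeff_infinite by blast
  have "(\<Sum>A\<in>Pow S. gsign A (S - A) * gcoeff f A * gcoeff g (S - A)) \<noteq> 0"
    using assms by (simp add: times_grassmann.rep_eq)
  then obtain A where "A \<in> Pow S" "gsign A (S - A) * gcoeff f A * gcoeff g (S - A) \<noteq> 0"
    by (rule sum.not_neutral_contains_not_neutral)
  then have A: "A \<subseteq> S" "gcoeff f A \<noteq> 0" "gcoeff g (S - A) \<noteq> 0" by auto
  have "card S = card A + card (S - A)"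
    using fin A(1) card_mono[OF fin A(1)] by (simp add: card_Diff_subset finite_subset)
  with fin A show thesis by (intro that)
qed

lemma geven_mult: "geven f \<Longrightarrow> geven g \<Longrightarrow> geven (f * g)"
  unfolding geven_def by (metis gcoeff_mult_nonzeroE even_add)

lemma godd_mult: "godd f \<Longrightarrow> godd g \<Longrightarrow> geven (f * g)"
  unfolding geven_def godd_def by (metis gcoeff_mult_nonzeroE even_add)

lemma geven_power: "geven f \<Longrightarrow> geven (f ^ n)"
  by (induction n) (simp_all add: geven_mult)

lemma geven_prod_list: "(\<And>f. f \<in> set fs \<Longrightarrow> geven f) \<Longrightarrow> geven (prod_list fs)"
  by (induction fs) (simp_all add: geven_mult)

text \<open>Passing to complements writes the opposite product as a sum over the same subsets; both
  commutation rules then reduce to comparing signs term by term.\<close>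

lemma gcoeff_mult_swap:
  "gcoeff (g * f) S = (\<Sum>A\<in>Pow S. gsign (S - A) A * gcoeff f A * gcoeff g (S - A))"
  unfolding times_grassmann.rep_eq
  by (rule sum.reindex_bij_witness[of _ "\<lambda>A. S - A" "\<lambda>A. S - A"])
     (auto simp: double_diff mult_ac)

lemma geven_commute:
  assumes "geven f"
  shows "f * g = g * f"
proof (rule grassmann_eqI)
  fix S :: "nat set" assume S: "finite S"
  show "gcoeff (f * g) S = gcoeff (g * f) S"
    unfolding gcoeff_mult_swap[of g f]
    unfolding times_grassmann.rep_eq
  proof (intro sum.cong refl)
    fix A assume "A \<in> Pow S"
    then have fin: "finite A" "finite (S - A)" using S finite_subset by auto
    show "gsign A (S - A) * gcoeff f A * gcoeff g (S - A) =
        gsign (S - A) A * gcoeff f A * gcoeff g (S - A)"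
      using assms gsign_commute[OF fin, where 'a = 'a]
      by (cases "even (card A)") (auto simp: geven_def)
  qed
qed

lemma godd_anticommute:
  assumes "godd f" "godd g"
  shows "f * g = - (g * f)"
proof (rule grassmann_eqI)
  fix S :: "nat set" assume S: "finite S"
  show "gcoeff (f * g) S = gcoeff (- (g * f)) S"
    unfolding uminus_grassmann.rep_eq gcoeff_mult_swap[of g f] sum_negf[symmetric]
    unfolding times_grassmann.rep_eq
  proof (intro sum.cong refl)
    fix A assume "A \<in> Pow S"
    then have fin: "finite A" "finite (S - A)" using S finite_subset by auto
    show "gsign A (S - A) * gcoeff f A * gcoeff g (S - A) =
        - (gsign (S - A) A * gcoeff f A * gcoeff g (S - A))"
      using assms gsign_commute[OF fin, where 'a = 'a]
      by (cases "even (card A) \<or> even (card (S - A))") (auto simp: godd_def)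
  qed
qed

lemma gscale_two: "f + f = gscale 2 f"
  by (rule grassmann_eqI) (simp add: gcoeff_simps)

lemma two_neq_zero:
  assumes "CHAR('k::field) \<noteq> 2"
  shows "(2 :: 'k) \<noteq> 0"
proof
  assume "(2 :: 'k) = 0"
  then have "CHAR('k) dvd 2" using of_nat_eq_0_iff_char_dvd[of 2, where 'a = 'k] by simp
  then have "CHAR('k) \<le> 2" "CHAR('k) \<noteq> 0" by (auto dest: dvd_imp_le intro: ccontr)
  with assms have "CHAR('k) = 1" by linarith
  then show False by simp
qed

lemma godd_square:
  fixes f :: "'k::field grassmann"
  assumes "godd f" "CHAR('k) \<noteq> 2"
  shows "f * f = 0"
proof -
  have "gscale 2 (f * f) = 0"
    using godd_anticommute[OF assms(1,1)] by (metis add.right_inverse gscale_two)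
  then show ?thesis using two_neq_zero[OF assms(2)] by simp
qed

lift_definition geven_part :: "'k::field grassmann \<Rightarrow> 'k grassmann"
  is "\<lambda>f A. if even (card A) then f A else 0"
  by (auto elim: rev_finite_subset)

lemma godd_decomp:
  obtains a u where "f = a + u" "geven a" "godd u" "gcoeff a {} = gcoeff f {}"
proof
  show "geven (geven_part f)" "godd (f - geven_part f)"
    by (simp_all add: geven_def godd_def gcoeff_diff geven_part.rep_eq)
qed (simp_all add: geven_part.rep_eq)

text \<open>Even elements are central, so only the odd parts contribute: a commutator is twice a
  product of differentials. This is where the powers of 2 come from.\<close>

lemma comm_decomp:
  fixes a :: "'k::field grassmann"
  assumes "geven a" "geven b" "godd u" "godd v"
  shows "comm (a + u) (b + v) = gscale 2 (u * v)"
  using geven_commute[OF assms(1), of b] geven_commute[OF assms(1), of v]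
    geven_commute[OF assms(2), of u] godd_anticommute[OF assms(4,3)]
  by (simp add: comm_def algebra_simps flip: gscale_two)

lemma geven_comm: "geven (comm f g)"
proof -
  obtain a u where f: "f = a + u" "geven a" "godd u" by (rule godd_decomp)
  obtain b v where g: "g = b + v" "geven b" "godd v" by (rule godd_decomp)
  from f g show ?thesis by (simp add: comm_decomp godd_mult)
qed

text \<open>The binomial expansion stops after the linear term. For \<open>n = 0\<close> the
  truncated exponent \<open>n - 1\<close> is harmless because its coefficient is 0.\<close>

lemma power_add_square_zero:
  fixes x z :: "'k::field grassmann"
  assumes "x * z = z * x" "z * z = 0"
  shows "(x + z) ^ n = x ^ n + gscale (of_nat n) (x ^ (n - 1) * z)"
proof (induction n)
  case (Suc n)
  note comm = power_commuting_commutes[OF assms(1)]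
  have z: "z * (x ^ (n - 1) * z) = 0"
    unfolding comm mult.assoc[symmetric] assms(2) by simp
  have x: "gscale (of_nat n) (x * (x ^ (n - 1) * z)) = gscale (of_nat n) (x ^ n * z)"
    by (cases n) (simp_all add: mult.assoc)
  have "(x + z) ^ Suc n = x * x ^ n + z * x ^ n + (gscale (of_nat n) (x * (x ^ (n - 1) * z))
      + gscale (of_nat n) (z * (x ^ (n - 1) * z)))"
    unfolding power_Suc Suc by (simp only: distrib_left distrib_right gscale_mult
      gr.scale_right_distrib add_ac)
  also have "\<dots> = x ^ Suc n + gscale (of_nat (Suc n)) (x ^ n * z)"
    unfolding x z comm[symmetric] by (simp add: gr.scale_left_distrib)
  finally show ?case by simp
qed simp

lemma gbasis_square: "A \<noteq> {} \<Longrightarrow> gbasis A * gbasis A = 0"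
proof (cases "finite A")
  case False
  then have "gbasis A = (0 :: 'a grassmann)" by (intro grassmann_eqI) (simp add: gcoeff_simps)
  then show ?thesis by simp
qed (simp add: gbasis_mult)

text \<open>Strip the odd part, then the basis elements of the even part one at a time. Each has
  square zero and commutes with the rest, so the p-th power changes by a linear term with
  coefficient p = 0. A constant term would survive; membership in \<open>grass0\<close> excludes
  it.\<close>

lemma grass0_power_char:
  fixes f :: "'k::field grassmann"
  assumes "f \<in> grass0" "CHAR('k) > 2"
  shows "f ^ CHAR('k) = 0"
proof -
  let ?p = "CHAR('k)"
  have step: "(x + z) ^ ?p = x ^ ?p" if "x * z = z * x" "z * z = 0" for x z :: "'k grassmann"
    by (simp add: power_add_square_zero[OF that])
  obtain a u where f: "f = a + u" and a: "geven a" and u: "godd u" and a0: "gcoeff a {} = gcoeff f {}"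
    by (rule godd_decomp)
  have "f ^ ?p = a ^ ?p"
    unfolding f using assms(2) by (intro step geven_commute a godd_square u) simp
  also have "a ^ ?p = 0"
  proof -
    let ?K = "{A. gcoeff a A \<noteq> 0}"
    have K: "even (card A)" "A \<noteq> {}" if "A \<in> ?K" for A
      using that a a0 assms(1) by (auto simp: geven_def grass0_eq)
    have fin: "finite ?K" using gcoeff[of a] by simp
    have "(\<Sum>A\<in>T. gscale (gcoeff a A) (gbasis A)) ^ ?p = 0" if "T \<subseteq> ?K" for T
      using finite_subset[OF that fin] that
    proof (induction T rule: finite_induct)
      case empty
      then show ?case using assms(2) by (simp add: zero_power)
    next
      case (insert A T)
      let ?z = "gscale (gcoeff a A) (gbasis A)"
      have "((\<Sum>A\<in>T. gscale (gcoeff a A) (gbasis A)) + ?z) ^ ?p =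
          (\<Sum>A\<in>T. gscale (gcoeff a A) (gbasis A)) ^ ?p"
      proof (rule step)
        show "?z * ?z = 0" using K[of A] insert.prems by (simp add: gscale_mult gbasis_square)
        have "geven ?z" using K[of A] insert.prems by (simp add: geven_gbasis)
        then show "sum (\<lambda>A. gscale (gcoeff a A) (gbasis A)) T * ?z =
            ?z * sum (\<lambda>A. gscale (gcoeff a A) (gbasis A)) T"
          using geven_commute by metis
      qed
      with insert show ?case by (simp add: add.commute)
    qed
    from this[OF order.refl] show ?thesis using gbasis_expansion[of a] by simp
  qed
  finally show ?thesis .
qed

text \<open>The commutator is \<open>2 u v\<close>, which annihilates further factors
  \<open>u\<close> and \<open>v\<close>; of the powers only \<open>a ^ m\<close> and
  \<open>b ^ n\<close> survive. With both exponents p - 1 these are the factors of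
  \<open>w_poly\<close>.\<close>

lemma geven_comm_power:
  fixes f g :: "'k::field grassmann"
  assumes "CHAR('k) \<noteq> 2"
  shows "geven (comm f g * f ^ m * g ^ n)"
proof -
  obtain a u where f: "f = a + u" and a: "geven a" and u: "godd u" by (rule godd_decomp)
  obtain b v where g: "g = b + v" and b: "geven b" and v: "godd v" by (rule godd_decomp)
  have intertwine: "c * x ^ k = y ^ k * c" if "c * x = y * c" for c x y :: "'k grassmann" and k
    using that by (induction k) (simp_all flip: mult.assoc, simp add: mult.assoc)
  have "u * v * u = 0" "u * v * v = 0"
    using godd_anticommute[OF v u] godd_square[OF u assms] godd_square[OF v assms]
    by (simp_all add: mult.assoc) (simp flip: mult.assoc)
  moreover have "a * (u * v) = u * v * a" "b * (u * v) = u * v * b"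
    by (intro geven_commute a b)+
  ultimately have 1: "u * v * (a + u) ^ m = a ^ m * (u * v)"
      and 2: "u * v * (b + v) ^ n = b ^ n * (u * v)"
    by (intro intertwine; simp add: distrib_left)+
  have "comm f g * f ^ m * g ^ n = gscale 2 (a ^ m * b ^ n * (u * v))"
    unfolding f g comm_decomp[OF a b u v] 
    by (simp only: gscale_mult 1 mult.assoc[of "a ^ m"] 2)
  then show ?thesis by (simp add: geven_mult geven_power a b godd_mult u v)
qed

lemma grass0_subspace: "gr.subspace grass0"
  by (simp add: grass0_def)

lemma grass0_mult: "f \<in> grass0 \<Longrightarrow> f * g \<in> grass0"
  by (simp add: grass0_eq times_grassmann.rep_eq)

text \<open>A component of \<open>z\<close> at an odd index set \<open>A\<close> is detected by a
  generator outside \<open>A\<close>: there are infinitely many generators, the two anticommute, and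
  2 is invertible.\<close>

lemma grass0_centre_eq:
  assumes "CHAR('k::field) \<noteq> 2"
  shows "grass0_centre = {z :: 'k grassmann. z \<in> grass0 \<and> geven z}"
proof (intro equalityI subsetI CollectI conjI)
  fix z :: "'k grassmann" assume z: "z \<in> grass0_centre"
  then show "z \<in> grass0" by (simp add: grass0_centre_def)
  show "geven z"
    unfolding geven_def
  proof (intro allI impI, rule ccontr)
    fix A assume A: "odd (card A)" "gcoeff z A \<noteq> 0"
    then have fin: "finite A" using gcoeff_infinite by blast
    then obtain n where n: "n \<notin> A" using ex_new_if_finite infinite_UNIV_nat by blast
    let ?e = "gbasis {n} :: 'k grassmann"
    have "?e \<in> grass0" by (simp add: grass0_eq gcoeff_simps)
    with z have "gcoeff (z * ?e) (insert n A) = gcoeff (?e * z) (insert n A)"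
      by (simp add: grass0_centre_def)
    moreover have "gcoeff (z * ?e) (insert n A) = gsign A {n} * gcoeff z A"
    proof -
      have [simp]: "insert n A - A = {n}" using n by auto
      have "C = A" if "C \<subseteq> insert n A" "insert n A - C = {n}" for C
        using that n by auto
      then have "gcoeff (z * ?e) (insert n A) =
          (\<Sum>C\<in>Pow (insert n A). if C = A then gsign A {n} * gcoeff z A else 0)"
        unfolding times_grassmann.rep_eq gbasis.rep_eq by (intro sum.cong) auto
      then show ?thesis using fin by (simp add: subset_insertI)
    qed
    moreover have "gcoeff (?e * z) (insert n A) = gsign {n} A * gcoeff z A"
    proof -
      have "gcoeff (?e * z) (insert n A) =
          (\<Sum>C\<in>Pow (insert n A). if C = {n} then gsign {n} A * gcoeff z A else 0)"
        unfolding times_grassmann.rep_eq gbasis.rep_eq using n by (intro sum.cong) auto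
      then show ?thesis using fin by simp
    qed
    moreover have "gsign A {n} = (- gsign {n} A :: 'k)"
      using gsign_commute[of A "{n}"] fin n A(1) by simp
    moreover have "gsign {n} A \<noteq> (0 :: 'k)" by (simp add: gsign_def)
    ultimately show False
      using A(2) two_neq_zero[OF assms] by (simp add: eq_neg_iff_add_eq_0 flip: mult_2)
  qed
qed (auto simp: grass0_centre_def intro: geven_commute)

section \<open>Reduction to standard monomials\<close>

text \<open>Consecutive letters are paired. A leftover letter makes the product 0, so that the
  permutation lemmas hold for lists of any length.\<close>

fun comm_word :: "nat list \<Rightarrow> 'k::field free_alg" where
  "comm_word [] = 1"
| "comm_word [i] = 0"
| "comm_word (i # j # js) = comm (var i) (var j) * comm_word js"

lemma comm_simps:
  "comm 0 f = 0" "comm f 0 = 0" "comm 1 f = 0" "comm f 1 = (0::'a::ring_1)"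
  by (simp_all add: comm_def)

lemma comm_mult_left: "comm (f * g) h = f * comm g h + comm f h * g" for f :: "'a::ring"
  by (simp add: comm_def algebra_simps)

lemma comm_mult_right: "comm h (f * g) = f * comm h g + comm h f * g" for f :: "'a::ring"
  by (simp add: comm_def algebra_simps)

lemma comm_skew: "comm f g = - comm g f"
  by (simp add: comm_def)

lemma comm_const: "comm (fscale c 1 + f) (fscale d 1 + g) = comm f g"
  by (simp add: comm_def algebra_simps fscale_mult_left fscale_mult_right)

text \<open>One interface for both characteristics: the generators involving p are demanded only if
  the characteristic is positive. \<open>S\<close> stands for the right-hand side of the
  theorem.\<close>

locale central_T_space =
  fixes S :: "'k::field free_alg set"
  assumes T_space: "T_space S"
    and char: "CHAR('k) \<noteq> 2"
    and comm_gen: "comm (var 1) (var 2) \<in> S"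
    and comm2_gen: "comm (var 1) (var 2) * comm (var 3) (var 4) \<in> S"
    and pow_gen: "CHAR('k) > 0 \<Longrightarrow> var 1 ^ CHAR('k) \<in> S"
    and pow2_gen: "CHAR('k) > 0 \<Longrightarrow> var 2 * var 1 ^ CHAR('k) \<in> S"
    and w_gen: "CHAR('k) > 0 \<Longrightarrow> n \<ge> 1 \<Longrightarrow> w_poly (CHAR('k)) n \<in> S"
begin

lemma subspace_S: "fa.subspace S"
  using T_space by (simp add: T_space_def)

lemmas S_closed = fa.subspace_0[OF subspace_S] fa.subspace_add[OF subspace_S]
  fa.subspace_diff[OF subspace_S] fa.subspace_neg[OF subspace_S] fa.subspace_scale[OF subspace_S]
  fa.subspace_sum[OF subspace_S]

lemma comm_in_S: "comm f g \<in> S"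
proof -
  obtain c f' where f: "f' \<in> free0" "f = fscale c 1 + f'" by (rule free0_const_decomp)
  obtain d g' where g: "g' \<in> free0" "g = fscale d 1 + g'" by (rule free0_const_decomp)
  let ?y = "\<lambda>i. if i = 1 then f' else g'"
  have "fau.evalp ?y (comm (var 1) (var 2)) \<in> S"
    by (rule T_space_evalp[OF T_space comm_gen]) (use f g in auto)
  then show ?thesis by (simp add: fau.evalp_comm f g comm_const)
qed

lemma comm2_in_S: "comm f g * comm h l \<in> S"
proof -
  obtain c f' where f: "f' \<in> free0" "f = fscale c 1 + f'" by (rule free0_const_decomp)
  obtain d g' where g: "g' \<in> free0" "g = fscale d 1 + g'" by (rule free0_const_decomp)
  obtain c' h' where h: "h' \<in> free0" "h = fscale c' 1 + h'" by (rule free0_const_decomp)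
  obtain d' l' where l: "l' \<in> free0" "l = fscale d' 1 + l'" by (rule free0_const_decomp)
  let ?y = "\<lambda>i. if i = 1 then f' else if i = 2 then g' else if i = 3 then h' else l'"
  have "fau.evalp ?y (comm (var 1) (var 2) * comm (var 3) (var 4)) \<in> S"
    by (rule T_space_evalp[OF T_space comm2_gen]) (use f g h l in auto)
  then show ?thesis by (simp add: fau.evalp_comm fau.evalp_mult f g h l comm_const)
qed

lemma mult_power_in_S:
  assumes "CHAR('k) > 0" "f \<in> free0"
  shows "g * f ^ CHAR('k) \<in> S"
proof -
  obtain c g' where g: "g' \<in> free0" "g = fscale c 1 + g'" by (rule free0_const_decomp)
  let ?y = "\<lambda>i. if i = 1 then f else g'"
  have "fau.evalp ?y (var 1 ^ CHAR('k)) \<in> S" "fau.evalp ?y (var 2 * var 1 ^ CHAR('k)) \<in> S"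
    using assms g by (intro T_space_evalp[OF T_space] pow_gen pow2_gen; simp)+
  then have "f ^ CHAR('k) \<in> S" "g' * f ^ CHAR('k) \<in> S"
    by (simp_all add: fau.evalp_mult fau.evalp_power)
  then show ?thesis by (simp add: g distrib_right fscale_mult_left S_closed)
qed

text \<open>The largest two-sided ideal contained in the T-space.\<close>

definition core :: "'k free_alg set" where
  "core = {f. \<forall>u v. u * f * v \<in> S}"

lemma core_closed:
  "0 \<in> core" "f \<in> core \<Longrightarrow> g \<in> core \<Longrightarrow> f + g \<in> core" "f \<in> core \<Longrightarrow> g \<in> core \<Longrightarrow> f - g \<in> core"
  "f \<in> core \<Longrightarrow> - f \<in> core"
  by (simp_all add: core_def S_closed distrib_left distrib_right left_diff_distrib right_diff_distrib)

lemma coreD: "f \<in> core \<Longrightarrow> u * f * v \<in> S"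
  by (simp add: core_def)

lemma core_mult_left: "f \<in> core \<Longrightarrow> u * f \<in> core"
  using coreD[of f "_ * u"] by (simp add: core_def mult.assoc)

lemma core_mult_right: "f \<in> core \<Longrightarrow> f * u \<in> core"
  using coreD[of f _ "u * _"] by (simp add: core_def mult.assoc)

lemma core_in_S: "f \<in> core \<Longrightarrow> f \<in> S"
  using coreD[of f 1 1] by simp

lemma core_minus_iff: "- f \<in> core \<longleftrightarrow> f \<in> core"
  using core_closed(4)[of f] core_closed(4)[of "- f"] by auto

lemma triple_comm_in_core: "comm (comm a b) c \<in> core"
  unfolding core_def
proof (intro CollectI allI)
  fix u v :: "'k free_alg"
  let ?A = "comm a b" and ?v = "v * u"
  \<comment> \<open>Rotating \<open>v\<close> to the front costs one commutator; the Leibniz rule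
    for \<open>comm (?v * ?A) c\<close> then leaves only a product of two commutators.\<close>
  have "u * comm ?A c * v =
      comm (u * comm ?A c) v + (comm (?v * ?A) c + comm c ?v * comm a b)"
    by (simp add: comm_def algebra_simps)
  then show "u * comm ?A c * v \<in> S" by (simp only:) (intro S_closed comm_in_S comm2_in_S)
qed

text \<open>The same rotation reduces two-sided multiples of the power to left multiples, which are
  substitution instances of the generators.\<close>

lemma power_in_core:
  assumes "CHAR('k) > 0" "f \<in> free0"
  shows "f ^ CHAR('k) \<in> core"
  unfolding core_def
proof (intro CollectI allI)
  fix u v :: "'k free_alg"
  have "u * f ^ CHAR('k) * v = comm (u * f ^ CHAR('k)) v + v * u * f ^ CHAR('k)"
    by (simp add: comm_def algebra_simps)
  then show "u * f ^ CHAR('k) * v \<in> S"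
    by (simp only:) (intro S_closed comm_in_S mult_power_in_S assms)
qed

section \<open>Calculus of differential forms modulo \<open>core\<close>\<close>

definition core_eq (infix "\<approx>" 50) where "f \<approx> g \<longleftrightarrow> f - g \<in> core"

lemma core_eq_refl [simp]: "f \<approx> f"
  by (simp add: core_eq_def core_closed)

lemma core_eq_sym: "f \<approx> g \<Longrightarrow> g \<approx> f"
  unfolding core_eq_def by (metis core_closed(4) minus_diff_eq)

lemma core_eq_trans [trans]: "f \<approx> g \<Longrightarrow> g \<approx> h \<Longrightarrow> f \<approx> h"
  unfolding core_eq_def using core_closed(2)[of "f - g" "g - h"] by simp

lemma core_eq_add: "f \<approx> f' \<Longrightarrow> g \<approx> g' \<Longrightarrow> f + g \<approx> f' + g'"
  unfolding core_eq_def using core_closed(2)[of "f - f'" "g - g'"] by (simp add: algebra_simps)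

lemma core_eq_mult: "f \<approx> f' \<Longrightarrow> g \<approx> g' \<Longrightarrow> f * g \<approx> f' * g'"
proof -
  assume "f \<approx> f'" "g \<approx> g'"
  then have "(f - f') * g + f' * (g - g') \<in> core"
    unfolding core_eq_def by (intro core_closed(2) core_mult_left core_mult_right)
  then show ?thesis by (simp add: core_eq_def algebra_simps)
qed

lemma comm_central: "comm a b * f \<approx> f * comm a b"
  using triple_comm_in_core[of a b f] by (simp add: core_eq_def comm_def[of "comm a b" f])

text \<open>Leibniz expansion of \<open>comm (comm x (y * z)) t\<close>: apart from triple
  commutators exactly these two products remain. In terms of forms, dy and dz anticommute across the
  boundary of two pairs.\<close>

lemma comm_exchange: "comm x y * comm z t + comm x z * comm y t \<in> core"
proof -
  have "comm (comm x (y * z)) t - y * comm (comm x z) t - comm (comm x y) t * z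
      + comm (comm x z) (comm y t) = comm x y * comm z t + comm x z * comm y t"
    by (simp add: comm_def algebra_simps)
  moreover have "comm (comm x (y * z)) t - y * comm (comm x z) t - comm (comm x y) t * z
      + comm (comm x z) (comm y t) \<in> core"
    by (intro core_closed core_mult_left core_mult_right triple_comm_in_core)
  ultimately show ?thesis by simp
qed

text \<open>Dropping pairs from the front of \<open>us\<close> leaves two cases: \<open>a\<close>
  and \<open>b\<close> form a pair, where the commutator is skew, or they lie in neighbouring pairs,
  where \<open>comm_exchange\<close> applies.\<close>

lemma comm_word_swap: "comm_word (us @ a # b # vs) + comm_word (us @ b # a # vs) \<in> core"
proof (induction us rule: comm_word.induct)
  case 1
  show ?case by (simp add: comm_def core_closed flip: distrib_right)
next
  case (2 i)
  show ?case
  proof (cases vs)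
    case (Cons t vs')
    then show ?thesis
      using core_mult_right[OF comm_exchange[of "var i" "var a" "var b" "var t"]]
      by (simp add: distrib_right mult.assoc)
  qed (simp add: core_closed)
next
  case (3 i j js)
  then show ?case by (simp add: core_mult_left flip: distrib_left)
qed

text \<open>The sign of the permutation is left open, because later only membership in subspaces is
  asked for.\<close>

lemma comm_word_perm:
  assumes "mset js = mset js'"
  shows "comm_word js \<approx> comm_word js' \<or> comm_word js \<approx> - comm_word js'"
  using _ _ _ assms
proof (rule prod_list_swap_induct)
  fix us a b vs
  show "comm_word (us @ a # b # vs) \<approx> comm_word (us @ b # a # vs) \<or>
      comm_word (us @ a # b # vs) \<approx> - comm_word (us @ b # a # vs)"
    using comm_word_swap by (simp add: core_eq_def)
next
  fix xs ys zs
  have neg: "- f \<approx> - g" if "f \<approx> g" for f g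
    using that core_minus_iff[of "f - g"] by (simp add: core_eq_def)
  assume "comm_word xs \<approx> comm_word ys \<or> comm_word xs \<approx> - comm_word ys"
    "comm_word ys \<approx> comm_word zs \<or> comm_word ys \<approx> - comm_word zs"
  then show "comm_word xs \<approx> comm_word zs \<or> comm_word xs \<approx> - comm_word zs"
    using neg[of "comm_word ys" "comm_word zs"] neg[of "comm_word ys" "- comm_word zs"]
    by (auto intro: core_eq_trans)
qed simp

lemma comm_word_not_distinct:
  assumes "\<not> distinct js"
  shows "comm_word js \<in> core"
proof -
  from assms obtain xs ys zs x where "js = xs @ [x] @ ys @ [x] @ zs"
    using not_distinct_decomp by blast
  then have m: "mset js = mset (x # x # xs @ ys @ zs)" by simp
  have "comm_word (x # x # xs @ ys @ zs) = (0 :: 'k free_alg)" by (simp add: comm_def)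
  with comm_word_perm[OF m] show ?thesis by (auto simp: core_eq_def)
qed

text \<open>Exact forms lie in the T-space: as \<open>?c\<close> is central modulo
  \<open>core\<close>, \<open>comm f g * ?c\<close> agrees with \<open>comm f (g * ?c)\<close>, so
  all further commutators can be absorbed into the second argument of the first.\<close>

lemma comm_comm_word_in_S: "even (length js) \<Longrightarrow> comm f g * comm_word js \<in> S"
proof (induction js arbitrary: g rule: comm_word.induct)
  case (3 i j js)
  let ?c = "comm (var i) (var j)"
  have "comm f (g * ?c) = g * comm f ?c + comm f g * ?c" by (rule comm_mult_right)
  also have "g * comm f ?c + comm f g * ?c \<approx> 0 + comm f g * ?c"
    using core_mult_left[OF triple_comm_in_core[of "var i" "var j" f], of "- g"]
    by (intro core_eq_add) (simp_all add: core_eq_def comm_skew[of f])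
  finally have "comm f (g * ?c) * comm_word js - comm f g * ?c * comm_word js \<in> core"
    unfolding core_eq_def by (simp add: core_mult_right flip: left_diff_distrib)
  moreover have "comm f (g * ?c) * comm_word js \<in> S" using 3 by simp
  ultimately have "comm f (g * ?c) * comm_word js -
      (comm f (g * ?c) * comm_word js - comm f g * ?c * comm_word js) \<in> S"
    by (blast intro: S_closed(3) core_in_S)
  then show ?case by (simp add: mult.assoc)
qed (simp_all add: comm_in_S)

end

text \<open>The variable along which the Poincare homotopy is taken in the multidegree B.\<close>

definition pivot :: "nat \<Rightarrow> nat multiset \<Rightarrow> nat" where
  "pivot p B = (LEAST l. \<not> p dvd count B l)"

text \<open>The normal forms w d(js). A pivot is required to exist, since \<open>LEAST\<close> is
  unspecified otherwise. For \<open>p = 0\<close> divisibility by p means being 0, so the pivot is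
  then the least variable that occurs; one definition serves both characteristics.\<close>

definition std_pairs :: "nat \<Rightarrow> (nat list \<times> nat list) set" where
  "std_pairs p = {(w, js). sorted w \<and> sorted js \<and> distinct js \<and> even (length js) \<and>
     (p > 0 \<longrightarrow> (\<forall>l. count (mset w) l < p)) \<and>
     (\<exists>l. \<not> p dvd count (mset (w @ js)) l) \<and> pivot p (mset (w @ js)) \<notin> set js}"

definition mon :: "nat list \<times> nat list \<Rightarrow> 'k::field free_alg" where
  "mon = (\<lambda>(w, js). monomial_word w * comm_word js)"

lemma mset_extract: "mset w = mset (replicate (count (mset w) l) l @ filter (\<lambda>x. x \<noteq> l) w)"
  by (rule multiset_eqI) (auto simp: count_mset count_list_eq_length_filter)

context central_T_space
begin

definition std_span :: "'k free_alg set" where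
  "std_span = fa.span (mon ` std_pairs (CHAR('k)) \<union> S)"

lemma std_span_closed:
  "f \<in> std_span \<Longrightarrow> g \<in> std_span \<Longrightarrow> f + g \<in> std_span"
  "f \<in> std_span \<Longrightarrow> g \<in> std_span \<Longrightarrow> f - g \<in> std_span" "f \<in> std_span \<Longrightarrow> - f \<in> std_span"
  "f \<in> std_span \<Longrightarrow> fscale c f \<in> std_span"
  by (simp_all add: std_span_def fa.span_add fa.span_diff fa.span_neg fa.span_scale)

lemma S_in_std_span: "f \<in> S \<Longrightarrow> f \<in> std_span"
  by (simp add: std_span_def fa.span_base)

lemma core_in_std_span: "f \<in> core \<Longrightarrow> f \<in> std_span"
  by (intro S_in_std_span core_in_S)

lemma std_span_diff_cong: "f - g \<in> std_span \<Longrightarrow> f \<in> std_span \<longleftrightarrow> g \<in> std_span"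
  using std_span_closed(2)[of f "f - g"] std_span_closed(1)[of g "f - g"] by auto

lemma std_span_cong: "f \<approx> g \<Longrightarrow> f \<in> std_span \<longleftrightarrow> g \<in> std_span"
  unfolding core_eq_def by (intro std_span_diff_cong core_in_std_span)

lemma std_span_minus: "- f \<in> std_span \<longleftrightarrow> f \<in> std_span"
  using std_span_closed(3)[of f] std_span_closed(3)[of "- f"] by auto

lemma mon_perm_comm_word:
  assumes "mset js = mset js'"
  shows "mon (w, js) \<in> std_span \<longleftrightarrow> mon (w, js') \<in> std_span"
  using comm_word_perm[OF assms]
proof
  assume "comm_word js \<approx> comm_word js'"
  then have "mon (w, js) \<approx> mon (w, js')" by (simp add: mon_def core_eq_mult)
  then show ?thesis by (rule std_span_cong)
next
  assume "comm_word js \<approx> - comm_word js'"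
  then have "mon (w, js) \<approx> monomial_word w * (- comm_word js')"
    by (simp only: mon_def prod.case core_eq_mult core_eq_refl)
  then have "mon (w, js) \<in> std_span \<longleftrightarrow> - mon (w, js') \<in> std_span" by (simp add: std_span_cong mon_def)
  then show ?thesis by (simp add: std_span_minus)
qed

text \<open>The Leibniz rule for d(r) dy d(js): one term for each letter \<open>z\<close> of
  \<open>r\<close>, its commutator moved to the right by centrality. The prefix \<open>a\<close>
  collects the letters already passed.\<close>

lemma comm_letter_in_std_span:
  assumes "\<And>r1 z r2. r = r1 @ z # r2 \<Longrightarrow> mon (a @ r1 @ r2, z # y # js) \<in> std_span"
  shows "monomial_word a * comm (monomial_word r) (var y) * comm_word js \<in> std_span"
  using assms
proof (induction r arbitrary: a)
  case Nil
  show ?case by (simp add: comm_simps std_span_def fa.span_zero)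
next
  case (Cons z r)
  have "monomial_word a * comm (monomial_word (z # r)) (var y) * comm_word js =
      monomial_word (a @ [z]) * comm (monomial_word r) (var y) * comm_word js
      + monomial_word a * (comm (var z) (var y) * monomial_word r) * comm_word js"
    by (simp add: comm_mult_left algebra_simps)
  moreover have "monomial_word (a @ [z]) * comm (monomial_word r) (var y) * comm_word js \<in> std_span"
  proof (rule Cons.IH)
    fix r1 x r2 assume "r = r1 @ x # r2"
    then show "mon ((a @ [z]) @ r1 @ r2, x # y # js) \<in> std_span"
      using Cons.prems[of "z # r1" x r2] by simp
  qed
  moreover have "monomial_word a * (comm (var z) (var y) * monomial_word r) * comm_word js \<in> std_span"
  proof -
    have "monomial_word a * (comm (var z) (var y) * monomial_word r) * comm_word js
        \<approx> monomial_word a * (monomial_word r * comm (var z) (var y)) * comm_word js"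
      by (intro core_eq_mult core_eq_refl comm_central)
    also have "\<dots> = mon (a @ r, z # y # js)" by (simp add: mon_def mult.assoc)
    finally show ?thesis using Cons.prems[of "[]" z r] by (simp add: std_span_cong)
  qed
  ultimately show ?case by (metis std_span_closed(1))
qed

lemma comm_power_letter:
  "comm (var i ^ n) (var y) \<approx> fscale (of_nat n) (var i ^ (n - 1) * comm (var i) (var y))"
proof (induction n)
  case 0
  show ?case by (simp add: comm_simps)
next
  case (Suc n)
  have "comm (var i ^ Suc n) (var y) =
      var i * comm (var i ^ n) (var y) + comm (var i) (var y) * var i ^ n"
    by (simp add: comm_mult_left)
  also have "\<dots> \<approx> var i * fscale (of_nat n) (var i ^ (n - 1) * comm (var i) (var y))
      + var i ^ n * comm (var i) (var y)"
    by (intro core_eq_add core_eq_mult core_eq_refl Suc comm_central)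
  also have "var i * fscale (of_nat n) (var i ^ (n - 1) * comm (var i) (var y)) =
      fscale (of_nat n) (var i ^ n * comm (var i) (var y))"
    by (cases n) (simp_all add: fscale_mult_right mult.assoc)
  finally show ?case by (simp add: fa.scale_left_distrib add.commute)
qed

text \<open>Up to moving central commutators, the product of the forms a^(p-1) da over
  \<open>js\<close> is a substitution instance of \<open>w_poly\<close> with half as many factors as
  \<open>js\<close> has letters.\<close>

lemma mon_power_comm_word_in_S:
  assumes "CHAR('k) \<noteq> 0" "even (length js)" "js \<noteq> []"
  shows "mon (concat (map (replicate (CHAR('k) - 1)) js), js) \<in> S"
proof -
  let ?m = "CHAR('k) - 1"
  define F :: "nat \<Rightarrow> nat \<Rightarrow> 'k free_alg"
    where "F i j = comm (var i) (var j) * var i ^ ?m * var j ^ ?m" for i j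
  let ?P = "\<lambda>js. prod_list (map (\<lambda>k. F (js ! (2 * k)) (js ! (2 * k + 1))) [0..<length js div 2])"
  have "mon (concat (map (replicate ?m) js), js) \<approx> ?P js"
    using assms(2)
  proof (induction js rule: comm_word.induct)
    case 1
    show ?case by (simp add: mon_def)
  next
    case (2 i)
    then show ?case by simp
  next
    case (3 i j js)
    let ?c = "comm (var i) (var j) :: 'k free_alg" and ?v = "var i ^ ?m * var j ^ ?m :: 'k free_alg"
    let ?W = "monomial_word (concat (map (replicate ?m) js)) :: 'k free_alg"
    have "mon (concat (map (replicate ?m) (i # j # js)), i # j # js) = ?v * ?W * ?c * comm_word js"
      by (simp add: mon_def mult.assoc)
    also have "\<dots> \<approx> ?c * (?v * ?W) * comm_word js"
      by (intro core_eq_mult core_eq_refl core_eq_sym[OF comm_central])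
    also have "\<dots> = F i j * mon (concat (map (replicate ?m) js), js)"
      by (simp add: mon_def F_def mult.assoc)
    also have "\<dots> \<approx> F i j * ?P js"
      using 3 by (intro core_eq_mult core_eq_refl) simp
    also have "\<dots> = ?P (i # j # js)"
      by (simp add: upt_conv_Cons comp_def del: upt_Suc flip: map_Suc_upt)
    finally show ?case .
  qed
  moreover have "?P js \<in> S"
  proof -
    \<comment> \<open>\<open>w_poly\<close> numbers its variables from 1, list positions start at
      0.\<close>
    let ?y = "\<lambda>i. var (js ! (i - 1)) :: 'k free_alg"
    have upt: "[1..<length js div 2 + 1] = map Suc [0..<length js div 2]"
      by (simp add: map_Suc_upt)
    have "fau.evalp ?y (w_poly (CHAR('k)) (length js div 2)) = ?P js"
      unfolding w_poly_def upt
      by (simp add: fau.evalp_prod_list fau.evalp_mult fau.evalp_comm fau.evalp_power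
          comp_def F_def)
    moreover have "length js div 2 \<ge> 1" using assms(2,3) by (cases js) (auto elim!: oddE)
    ultimately show ?thesis
      using T_space_evalp[OF T_space w_gen, of "length js div 2" ?y] assms(1) by simp
  qed
  ultimately have "mon (concat (map (replicate ?m) js), js) - ?P js + ?P js \<in> S"
    unfolding core_eq_def by (blast intro: S_closed(2) core_in_S)
  then show ?thesis by (simp only: diff_add_cancel)
qed

section \<open>The induction step on the length of the word part\<close>

context fixes n :: nat
  assumes shorter: "\<And>w js. length w < n \<Longrightarrow> even (length js) \<Longrightarrow> w @ js \<noteq> [] \<Longrightarrow> mon (w, js) \<in> std_span"
begin

text \<open>Exchanging two letters leaves their commutator, which moves into the commutator word;
  the word part of this correction is shorter by two, so \<open>shorter\<close> applies.\<close>

lemma mon_perm_word: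
  assumes "even (length js)" "length w = n" "mset w = mset w'"
  shows "mon (w, js) \<in> std_span \<longleftrightarrow> mon (w', js) \<in> std_span"
proof -
  have "length w = n \<longrightarrow> length w' = n \<and> (mon (w, js) \<in> std_span \<longleftrightarrow> mon (w', js) \<in> std_span)"
    using _ _ _ assms(3)
  proof (rule prod_list_swap_induct)
    fix us a b vs
    show "length (us @ a # b # vs) = n \<longrightarrow> length (us @ b # a # vs) = n \<and>
        (mon (us @ a # b # vs, js) \<in> std_span \<longleftrightarrow> mon (us @ b # a # vs, js) \<in> std_span)"
    proof
      assume n: "length (us @ a # b # vs) = n"
      have "mon (us @ a # b # vs, js) - mon (us @ b # a # vs, js) =
          monomial_word us * (comm (var a) (var b) * monomial_word vs) * comm_word js"
        by (simp add: mon_def comm_def algebra_simps)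
      also have "\<dots> \<approx> monomial_word us * (monomial_word vs * comm (var a) (var b)) * comm_word js"
        by (intro core_eq_mult core_eq_refl comm_central)
      also have "\<dots> = mon (us @ vs, a # b # js)" by (simp add: mon_def mult.assoc)
      finally have "mon (us @ a # b # vs, js) - mon (us @ b # a # vs, js) \<in> std_span"
        using shorter[of "us @ vs" "a # b # js"] n assms(1) by (simp add: std_span_cong)
      with n show "length (us @ b # a # vs) = n \<and>
          (mon (us @ a # b # vs, js) \<in> std_span \<longleftrightarrow> mon (us @ b # a # vs, js) \<in> std_span)"
        by (simp add: std_span_diff_cong)
    qed
  qed auto
  with assms(2) show ?thesis by simp
qed

lemma mon_high_power_in_std_span:
  assumes "even (length js)" "length w = n" "CHAR('k) > 0" "count (mset w) l \<ge> CHAR('k)"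
  shows "mon (w, js) \<in> std_span"
proof -
  obtain m where m: "count (mset w) l = CHAR('k) + m" using assms(4) le_Suc_ex by blast
  let ?w = "replicate (count (mset w) l) l @ filter (\<lambda>x. x \<noteq> l) w"
  have eq: "mon (?w, js) =
      var l ^ CHAR('k) * (var l ^ m * monomial_word (filter (\<lambda>x. x \<noteq> l) w) * comm_word js)"
    by (simp add: mon_def m power_add mult.assoc)
  have "mon (?w, js) \<in> std_span"
    unfolding eq by (intro core_in_std_span core_mult_right power_in_core assms var_in_free0)
  with mon_perm_word[OF assms(1,2) mset_extract] show ?thesis by blast
qed

text \<open>Sorting both components gives a standard pair, unless a letter repeats in
  \<open>js\<close> or a p-th power splits off; in these cases the monomial is reducible by the
  ideal \<open>core\<close>.\<close>

lemma mon_pivot_free_in_std_span: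
  assumes "even (length js)" "length w = n"
    and "\<not> CHAR('k) dvd count (mset (w @ js)) l" "pivot (CHAR('k)) (mset (w @ js)) \<notin> set js"
  shows "mon (w, js) \<in> std_span"
proof (cases "distinct js \<and> (CHAR('k) > 0 \<longrightarrow> (\<forall>l. count (mset w) l < CHAR('k)))")
  case True
  have "(sort w, sort js) \<in> std_pairs (CHAR('k))"
    using assms True by (auto simp: std_pairs_def)
  then have "mon (sort w, sort js) \<in> std_span" unfolding std_span_def by (intro fa.span_base) auto
  then show ?thesis
    using mon_perm_word[of "sort js" w "sort w"] mon_perm_comm_word[of js "sort js" w] assms
    by simp
next
  case False
  then consider "\<not> distinct js" | l where "CHAR('k) > 0" "count (mset w) l \<ge> CHAR('k)"
    by (auto simp: not_less)
  then show ?thesis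
  proof cases
    case 1
    then show ?thesis
      by (simp add: mon_def core_in_std_span core_mult_left comm_word_not_distinct)
  next
    case 2
    then show ?thesis using assms by (intro mon_high_power_in_std_span)
  qed
qed

lemma mon_pivot_in_std_span:
  assumes "even (length js)" "length w = n"
    and ndvd: "\<not> CHAR('k) dvd count (mset (w @ js)) l"
    and pivot: "i = pivot (CHAR('k)) (mset (w @ js))" and "i \<in> set js" and dist: "distinct js"
  shows "mon (w, js) \<in> std_span"
proof -
  from \<open>i \<in> set js\<close> obtain us vs where us: "js = us @ i # vs" by (meson split_list)
  \<comment> \<open>Even length provides a second letter \<open>y\<close>, which serves as the
    partner of \<open>i\<close> in a commutator.\<close>
  with assms(1) have "us @ vs \<noteq> []" by auto
  then obtain y js' where js': "us @ vs = y # js'" by (cases "us @ vs") auto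
  have mjs: "mset js = mset (i # y # js')" using us by (simp flip: js')
  have i: "i \<noteq> y" "i \<notin> set js'" "even (length js')"
    using dist assms(1) mset_eq_length[OF mjs] mset_eq_imp_distinct_iff[OF mjs] by auto
  let ?m = "count (mset w) i" and ?r = "filter (\<lambda>x. x \<noteq> i) w"
  \<comment> \<open>\<open>i\<close> occurs exactly once in the distinct list \<open>js\<close>, so
    the multidegree in \<open>i\<close> is \<open>Suc ?m\<close>; its pivot property makes this
    invertible in the field.\<close>
  have ndvd_i: "\<not> CHAR('k) dvd Suc ?m"
  proof -
    have "\<not> CHAR('k) dvd count (mset (w @ js)) i"
      unfolding pivot pivot_def using ndvd by (rule LeastI)
    moreover have "count (mset js') i = 0" using i by (simp add: count_mset_0_iff)
    ultimately show ?thesis using i mjs by simp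
  qed
  \<comment> \<open>Expand the exact form d(x(i)^(m+1) r) dy ... by the Leibniz rule and solve for the term
    in which x(i) is differentiated; its coefficient m + 1 is invertible.\<close>
  have "comm (monomial_word (replicate (Suc ?m) i @ ?r)) (var y) * comm_word js' \<in> std_span"
    using i by (intro S_in_std_span comm_comm_word_in_S)
  also have "comm (monomial_word (replicate (Suc ?m) i @ ?r)) (var y) * comm_word js' =
      monomial_word (replicate (Suc ?m) i) * comm (monomial_word ?r) (var y) * comm_word js'
      + comm (var i ^ Suc ?m) (var y) * monomial_word ?r * comm_word js'" (is "_ = ?A + ?B")
    by (simp only: monomial_word_simps comm_mult_left distrib_right)
  finally have AB: "?A + ?B \<in> std_span" .
  have "?A \<in> std_span"
  proof (rule comm_letter_in_std_span)
    fix r1 z r2 assume r: "?r = r1 @ z # r2"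
    have "z \<in> set ?r" unfolding r by simp
    then have "z \<noteq> i" by simp
    let ?w = "replicate (Suc ?m) i @ r1 @ r2"
    \<comment> \<open>In \<open>?w\<close> an extra \<open>i\<close> replaces \<open>z\<close>:
      length, multidegree and pivot are unchanged, but \<open>i\<close> no longer occurs in the
      commutator word.\<close>
    have mw: "mset w = mset (replicate ?m i @ r1 @ z # r2)" using mset_extract[of w i] r by simp
    then have m: "mset (?w @ z # y # js') = mset (w @ js)" using mjs by simp
    have len: "length ?w = n" using mset_eq_length[OF mw] assms(2) by simp
    show "mon (?w, z # y # js') \<in> std_span"
      by (rule mon_pivot_free_in_std_span[where l = l]; (unfold m)?)
         (use i \<open>z \<noteq> i\<close> ndvd len pivot in auto)
  qed
  with AB have "?B \<in> std_span" using std_span_closed(2)[of "?A + ?B" ?A] by simp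
  have "?B \<approx> fscale (of_nat (Suc ?m)) (var i ^ ?m * comm (var i) (var y))
      * monomial_word ?r * comm_word js'"
    using comm_power_letter[of i "Suc ?m" y] by (intro core_eq_mult core_eq_refl) simp
  also have "\<dots> = fscale (of_nat (Suc ?m)) (var i ^ ?m) * (comm (var i) (var y) * monomial_word ?r)
      * comm_word js'"
    by (simp only: fscale_mult_left mult.assoc)
  also have "\<dots> \<approx> fscale (of_nat (Suc ?m)) (var i ^ ?m) * (monomial_word ?r * comm (var i) (var y))
      * comm_word js'"
    by (intro core_eq_mult core_eq_refl comm_central)
  also have "\<dots> = fscale (of_nat (Suc ?m)) (mon (replicate ?m i @ ?r, i # y # js'))"
    by (simp only: mon_def prod.case monomial_word_simps comm_word.simps fscale_mult_left mult.assoc)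
  finally have "fscale (of_nat (Suc ?m)) (mon (replicate ?m i @ ?r, i # y # js')) \<in> std_span"
    using \<open>?B \<in> std_span\<close> std_span_cong by blast
  moreover have "of_nat (Suc ?m) \<noteq> (0 :: 'k)"
    using ndvd_i by (simp only: of_nat_eq_0_iff_char_dvd not_False_eq_True)
  ultimately have "mon (replicate ?m i @ ?r, i # y # js') \<in> std_span"
    using std_span_closed(4)[of "fscale (of_nat (Suc ?m)) (mon (replicate ?m i @ ?r, i # y # js'))"
      "inverse (of_nat (Suc ?m))"] by (simp del: of_nat_Suc)
  then show ?thesis
    using mon_perm_word[OF _ _ mset_extract[of w i], of "i # y # js'"] mon_perm_comm_word[OF mjs]
      i assms(2) by simp
qed

text \<open>There is no pivot here. Unless a p-th power splits off, every letter occurs fewer than p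
  times in \<open>w\<close> and at most once in \<open>js\<close>; divisibility forces p - 1
  occurrences in \<open>w\<close> for letters of \<open>js\<close> and none for others, which is an
  instance of \<open>w_poly\<close>.\<close>

lemma mon_all_dvd_in_std_span:
  assumes "even (length js)" "length w = n" "w @ js \<noteq> []"
    and dvd: "\<And>l. CHAR('k) dvd count (mset (w @ js)) l"
    and "distinct js"
  shows "mon (w, js) \<in> std_span"
proof -
  let ?p = "CHAR('k)"
  \<comment> \<open>Divisibility by 0 would make all multiplicities vanish, although some letter
    occurs.\<close>
  have "?p \<noteq> 0"
  proof
    assume "?p = 0"
    with dvd have "mset (w @ js) = {#}" by (intro multiset_eqI) simp
    with assms(3) show False by simp
  qed
  show ?thesis
  proof (cases "\<exists>l. count (mset w) l \<ge> ?p")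
    case True
    with \<open>?p \<noteq> 0\<close> assms(1,2) show ?thesis by (auto intro: mon_high_power_in_std_span)
  next
    case False
    have "mset w = mset (concat (map (replicate (?p - 1)) js))"
    proof (rule multiset_eqI)
      fix l :: nat
      have *: "count (mset (concat (map (replicate m) xs))) l = m * count (mset xs) l"
        for m and xs :: "nat list"
        by (induction xs) auto
      have js: "count (mset js) l = (if l \<in> set js then 1 else 0)"
        using \<open>distinct js\<close> unfolding distinct_count_atmost_1 by blast
      have lt: "count (mset w) l < ?p" using False by (simp add: not_le)
      have dvd': "?p dvd count (mset w) l + count (mset js) l" using dvd[of l] by simp
      show "count (mset w) l = count (mset (concat (map (replicate (?p - 1)) js))) l"
      proof (cases "l \<in> set js")
        case True
        with dvd' have "?p \<le> Suc (count (mset w) l)" by (intro dvd_imp_le) (simp_all add: js)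
        with True lt show ?thesis by (simp add: * js)
      next
        case False
        with dvd' lt have "count (mset w) l = 0"
          using nat_dvd_not_less[of "count (mset w) l" ?p] by (simp add: js) blast
        with False show ?thesis by (simp add: * js)
      qed
    qed
    moreover have "js \<noteq> []"
      using calculation assms(3) by (cases js) auto
    moreover from this have "mon (concat (map (replicate (?p - 1)) js), js) \<in> std_span"
      by (intro S_in_std_span mon_power_comm_word_in_S \<open>?p \<noteq> 0\<close> assms(1))
    ultimately show ?thesis using mon_perm_word[OF assms(1,2)] by simp
  qed
qed

lemma mon_in_std_span_step:
  assumes "even (length js)" "length w = n" "w @ js \<noteq> []"
  shows "mon (w, js) \<in> std_span"
proof (cases "distinct js")
  case True
  show ?thesis
  proof (cases "\<forall>l. CHAR('k) dvd count (mset (w @ js)) l")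
    case dvd: True
    show ?thesis by (rule mon_all_dvd_in_std_span[OF assms _ True]) (use dvd in blast)
  next
    case False
    then obtain l where l: "\<not> CHAR('k) dvd count (mset (w @ js)) l" by blast
    show ?thesis
      using mon_pivot_free_in_std_span[OF assms(1,2) l]
        mon_pivot_in_std_span[OF assms(1,2) l refl _ True]
      by (cases "pivot (CHAR('k)) (mset (w @ js)) \<in> set js") simp_all
  qed
next
  case False
  then show ?thesis by (simp add: mon_def core_in_std_span core_mult_left comm_word_not_distinct)
qed

end

lemma mon_in_std_span: "even (length js) \<Longrightarrow> w @ js \<noteq> [] \<Longrightarrow> mon (w, js) \<in> std_span"
proof (induction "length w" arbitrary: w js rule: less_induct)
  case less
  show ?case by (rule mon_in_std_span_step[OF less(1) less(2) refl less(3)])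
qed

lemma free0_subset_std_span: "free0 \<subseteq> std_span"
  unfolding free0_def
proof (rule fa.span_minimal)
  show "monomial_word ` {w. w \<noteq> []} \<subseteq> std_span"
  proof (intro subsetI, elim imageE CollectE)
    fix f :: "'k free_alg" and w assume "f = monomial_word w" "w \<noteq> []"
    then show "f \<in> std_span" using mon_in_std_span[of "[]" w] by (simp add: mon_def)
  qed
  show "fa.subspace std_span" by (simp add: std_span_def)
qed

end

section \<open>Linear independence of the standard monomials\<close>

lemma geven_godd_mult: "geven f \<Longrightarrow> godd g \<Longrightarrow> godd (f * g)"
  unfolding geven_def godd_def by (metis gcoeff_mult_nonzeroE even_add)

lemma godd_geven_mult: "godd f \<Longrightarrow> geven g \<Longrightarrow> godd (f * g)"
  using geven_godd_mult[of g f] by (simp add: geven_commute)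

lemma godd_prod_list:
  assumes "\<And>i. godd (u i)"
  shows "(even (length js) \<longrightarrow> geven (prod_list (map u js))) \<and>
    (odd (length js) \<longrightarrow> godd (prod_list (map u js)))"
  using assms by (induction js) (auto intro: godd_mult godd_geven_mult)

text \<open>Anticommute \<open>u l\<close> up to its own copy in the list, where the square
  vanishes.\<close>

lemma godd_mult_prod_list_zero:
  fixes u :: "nat \<Rightarrow> 'k::field grassmann"
  assumes char: "CHAR('k) \<noteq> 2" and u: "\<And>i. godd (u i)" and "l \<in> set js"
  shows "u l * prod_list (map u js) = 0"
  using assms(3)
proof (induction js)
  case (Cons x js)
  have "u l * u x * prod_list (map u js) = 0"
  proof (cases "l = x")
    case True
    then show ?thesis by (simp add: godd_square[OF u char])
  next
    case False
    with Cons show ?thesis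
      by (simp add: godd_anticommute[OF u u, of l x] mult.assoc)
  qed
  then show ?case by (simp add: mult.assoc)
qed simp

lemma prod_list_geven_perm:
  assumes "\<And>i. geven (a i)" "mset w = mset w'"
  shows "prod_list (map a w) = prod_list (map a w')"
  using _ _ _ assms(2)
proof (rule prod_list_swap_induct)
  fix us x y vs
  have "a x * (a y * P) = a y * (a x * P)" for P
    using geven_commute[OF assms(1), of x "a y"] by (simp flip: mult.assoc)
  then show "prod_list (map a (us @ x # y # vs)) = prod_list (map a (us @ y # x # vs))" by simp
qed simp_all

context
  fixes a u :: "nat \<Rightarrow> 'k::field grassmann"
  assumes char: "CHAR('k) \<noteq> 2" and a: "\<And>i. geven (a i)" and u: "\<And>i. godd (u i)"
begin

lemma evalp_comm_word:
  "even (length js) \<Longrightarrow> gru.evalp (\<lambda>i. a i + u i) (comm_word js) =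
    gscale (2 ^ (length js div 2)) (prod_list (map u js))"
  by (induction js rule: comm_word.induct)
     (simp_all add: gru.evalp_mult gru.evalp_comm comm_decomp a u gscale_mult mult.assoc)

text \<open>The first-order Taylor expansion behind omega + d omega. Factors \<open>u l\<close> with
  \<open>l \<noteq> j\<close> die on \<open>U\<close>, second-order terms die on
  \<open>u j * U\<close>, so only the partial derivative along \<open>j\<close> is left.\<close>

lemma prod_list_decomp:
  assumes U: "\<And>l. l \<noteq> j \<Longrightarrow> u l * U = 0"
  shows "prod_list (map (\<lambda>i. a i + u i) w) * U = prod_list (map a w) * U +
    gscale (of_nat (count (mset w) j)) (prod_list (map a (remove1 j w)) * (u j * U))"
proof (induction w)
  case (Cons l w)
  let ?c = "of_nat (count (mset w) j) :: 'k"
  have even: "geven (prod_list (map a v))" for v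
    by (intro geven_prod_list) (auto simp: a)
  have move: "u l * (prod_list (map a v) * V) = prod_list (map a v) * (u l * V)" for v V
    using geven_commute[OF even, of v "u l"] by (simp flip: mult.assoc)
  have 0: "u l * (u j * U) = 0"
  proof (cases "l = j")
    case True
    then show ?thesis by (simp add: godd_square[OF u char] flip: mult.assoc)
  next
    case False
    have "u l * (u j * U) = - (u j * (u l * U))"
      using godd_anticommute[OF u u, of l j] by (simp flip: mult.assoc)
    with U[OF False] show ?thesis by simp
  qed
  have "prod_list (map (\<lambda>i. a i + u i) (l # w)) * U =
      (a l + u l) * (prod_list (map a w) * U
        + gscale ?c (prod_list (map a (remove1 j w)) * (u j * U)))"
    by (simp add: Cons mult.assoc)
  also have "\<dots> = a l * prod_list (map a w) * U + prod_list (map a w) * (u l * U)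
      + gscale ?c (a l * prod_list (map a (remove1 j w)) * (u j * U))"
    by (simp add: distrib_left distrib_right gscale_mult move 0 mult.assoc)
  also have "\<dots> = prod_list (map a (l # w)) * U +
      gscale (of_nat (count (mset (l # w)) j)) (prod_list (map a (remove1 j (l # w))) * (u j * U))"
  proof (cases "l = j")
    case True
    \<comment> \<open>If \<open>j\<close> occurs in \<open>w\<close>, the factor \<open>a j\<close>
      restores the removed letter; if not, both sides have coefficient 0.\<close>
    have "gscale ?c (a j * prod_list (map a (remove1 j w))) = gscale ?c (prod_list (map a w))"
    proof (cases "j \<in> set w")
      case True
      then have "prod_list (map a w) = prod_list (map a (j # remove1 j w))"
        by (intro prod_list_geven_perm a) simp
      then show ?thesis by simp
    next
      case False
      then show ?thesis by (simp add: count_mset_0_iff[THEN iffD2])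
    qed
    then have "gscale ?c (a j * prod_list (map a (remove1 j w)) * (u j * U)) =
        gscale ?c (prod_list (map a w) * (u j * U))"
      by (metis gscale_mult(1))
    with True show ?thesis by (simp add: gr.scale_left_distrib add_ac)
  next
    case False
    then show ?thesis by (simp add: U mult.assoc)
  qed
  finally show ?case .
qed simp

end

section \<open>Generic even and odd elements with controlled nilpotency\<close>

definition nonzero_multiple :: "'k::field grassmann \<Rightarrow> nat set \<Rightarrow> bool" where
  "nonzero_multiple f A \<longleftrightarrow> finite A \<and> (\<exists>c. c \<noteq> 0 \<and> f = gscale c (gbasis A))"

lemma nonzero_multiple_gbasis: "finite A \<Longrightarrow> nonzero_multiple (gbasis A) A"
  unfolding nonzero_multiple_def by (intro conjI exI[of _ 1]) simp_all

lemma nonzero_multiple_scale: "c \<noteq> 0 \<Longrightarrow> nonzero_multiple f A \<Longrightarrow> nonzero_multiple (gscale c f) A"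
  unfolding nonzero_multiple_def by (auto intro: exI[of _ "c * _"])

lemma nonzero_multiple_mult:
  assumes "nonzero_multiple f A" "nonzero_multiple g B" "A \<inter> B = {}"
  shows "nonzero_multiple (f * g) (A \<union> B)"
proof -
  from assms obtain c d where *: "finite A" "finite B" "c \<noteq> 0" "d \<noteq> 0"
    "f = gscale c (gbasis A)" "g = gscale d (gbasis B)" by (auto simp: nonzero_multiple_def)
  then have "f * g = gscale (c * d * gsign A B) (gbasis (A \<union> B))"
    by (simp add: gscale_mult gbasis_mult assms(3) mult_ac)
  moreover have "c * d * gsign A B \<noteq> 0" using * by (simp add: gsign_def)
  ultimately show ?thesis using * unfolding nonzero_multiple_def by blast
qed

lemma nonzero_multiple_one: "nonzero_multiple 1 {}"
proof -
  have "gbasis {} = (1 :: 'a grassmann)"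
    by (rule grassmann_eqI) (simp add: one_grassmann.rep_eq gbasis.rep_eq)
  then show ?thesis using nonzero_multiple_gbasis[of "{}", where 'a = 'a] by simp
qed

lemma nonzero_multiple_coeff: "nonzero_multiple f A \<Longrightarrow> gcoeff f A \<noteq> 0"
  by (auto simp: nonzero_multiple_def gscale.rep_eq gbasis.rep_eq)

text \<open>The generators are split into one infinite family for each variable \<open>l\<close>,
  encoded as \<open>(l, j)\<close>: \<open>j = 0\<close> is the odd generator, and the positive
  \<open>j\<close> come in consecutive pairs. A sum of \<open>n\<close> such pairs has n-th power n!
  times their product and vanishing higher powers, so it bounds the exponent of the variable by
  \<open>n\<close>.\<close>

definition even_gen :: "nat \<Rightarrow> nat \<Rightarrow> 'k::field grassmann" where
  "even_gen l n = (\<Sum>t<n. gbasis {prod_encode (l, 2 * t + 1), prod_encode (l, 2 * t + 2)})"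

definition odd_gen :: "nat \<Rightarrow> 'k::field grassmann" where
  "odd_gen l = gbasis {prod_encode (l, 0)}"

definition even_support :: "nat \<Rightarrow> nat \<Rightarrow> nat set" where
  "even_support l n = prod_encode ` ({l} \<times> {1..2 * n})"

lemma godd_odd_gen: "godd (odd_gen l)"
  by (simp add: odd_gen_def godd_gbasis)

lemma geven_pair: "geven (gbasis {prod_encode (l, 2 * t + 1), prod_encode (l, 2 * t + 2)})"
  by (intro geven_gbasis) simp

lemma geven_even_gen: "geven (even_gen l n)"
proof (induction n)
  case (Suc n)
  have "(even_gen l (Suc n) :: 'a grassmann) =
      even_gen l n + gbasis {prod_encode (l, 2 * n + 1), prod_encode (l, 2 * n + 2)}"
    by (simp add: even_gen_def)
  then show ?case by (simp only:) (intro geven_simps Suc geven_pair)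
qed (simp add: even_gen_def)

lemma even_gen_power_Suc:
  fixes l n
  defines "z \<equiv> gbasis {prod_encode (l, 2 * n + 1), prod_encode (l, 2 * n + 2)}"
  shows "even_gen l (Suc n) ^ m = even_gen l n ^ m + gscale (of_nat m) (even_gen l n ^ (m - 1) * z)"
proof -
  have "even_gen l (Suc n) = even_gen l n + z" by (simp add: even_gen_def z_def)
  then show ?thesis
    unfolding z_def
    by (simp only:) (intro power_add_square_zero geven_commute geven_even_gen gbasis_square; simp)
qed

lemma even_gen_power_zero: "m > n \<Longrightarrow> even_gen l n ^ m = 0"
proof (induction n arbitrary: m)
  case 0
  then show ?case by (simp add: even_gen_def zero_power)
next
  case (Suc n)
  then show ?case by (simp add: even_gen_power_Suc)
qed

text \<open>In the expansion of the power \<open>Suc n\<close>, the first term vanishes by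
  nilpotency and the linear one contributes the factor \<open>Suc n\<close>. The accumulated n! is
  nonzero because \<open>n\<close> stays below a positive characteristic.\<close>

lemma nonzero_multiple_even_gen_power:
  assumes "CHAR('k::field) > 0 \<longrightarrow> n < CHAR('k)"
  shows "nonzero_multiple (even_gen l n ^ n :: 'k grassmann) (even_support l n)"
  using assms
proof (induction n)
  case 0
  then show ?case by (simp add: nonzero_multiple_one even_support_def)
next
  case (Suc n)
  let ?z = "{prod_encode (l, 2 * n + 1), prod_encode (l, 2 * n + 2)}"
  have "{1..2 * Suc n} = {1..2 * n} \<union> {2 * n + 1, 2 * n + 2}" by auto
  then have sup: "even_support l (Suc n) = even_support l n \<union> ?z"
    by (simp add: even_support_def image_Un Sigma_Un_distrib2)
  have "of_nat (Suc n) \<noteq> (0 :: 'k)"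
    using Suc.prems by (simp add: of_nat_eq_0_iff_char_dvd del: of_nat_Suc) (auto dest: dvd_imp_le)
  moreover have "nonzero_multiple (even_gen l n ^ n * gbasis ?z :: 'k grassmann) (even_support l (Suc n))"
    unfolding sup using Suc
    by (intro nonzero_multiple_mult nonzero_multiple_gbasis) (auto simp: even_support_def)
  ultimately show ?case
    by (simp add: even_gen_power_Suc even_gen_power_zero nonzero_multiple_scale del: power_Suc of_nat_Suc)
qed

lemma even_gen_prod_split:
  "prod_list (map (\<lambda>l. even_gen l (\<gamma> l)) w) = even_gen l (\<gamma> l) ^ count (mset w) l *
    prod_list (map (\<lambda>l. even_gen l (\<gamma> l)) (filter (\<lambda>x. x \<noteq> l) w))"
  by (subst prod_list_geven_perm[OF geven_even_gen mset_extract[of w l]]) simp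

lemma even_gen_prod_zero:
  "count (mset w) l > \<gamma> l \<Longrightarrow> prod_list (map (\<lambda>l. even_gen l (\<gamma> l)) w) = 0"
  by (simp add: even_gen_prod_split[of \<gamma> w l] even_gen_power_zero)

text \<open>The induction removes all occurrences of a letter at once, which keeps the multiplicity
  condition for the remaining letters.\<close>

lemma nonzero_multiple_even_gen_prod:
  assumes "CHAR('k::field) > 0 \<longrightarrow> (\<forall>l. \<gamma> l < CHAR('k))"
    and "\<forall>l\<in>set w. count (mset w) l = \<gamma> l"
  shows "nonzero_multiple (prod_list (map (\<lambda>l. even_gen l (\<gamma> l) :: 'k grassmann) w))
    (\<Union>l\<in>set w. even_support l (\<gamma> l))"
  using assms(2)
proof (induction "length w" arbitrary: w rule: less_induct)
  case less
  show ?case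
  proof (cases w)
    case Nil
    then show ?thesis by (simp add: nonzero_multiple_one)
  next
    case (Cons l w')
    let ?w = "filter (\<lambda>x. x \<noteq> l) w"
    have "length ?w < length w" using Cons by (simp add: le_imp_less_Suc)
    moreover have "count (mset ?w) x = \<gamma> x" if "x \<in> set ?w" for x
      using less.prems that by simp
    ultimately have IH: "nonzero_multiple (prod_list (map (\<lambda>l. even_gen l (\<gamma> l) :: 'k grassmann) ?w))
        (\<Union>l\<in>set ?w. even_support l (\<gamma> l))"
      using less.hyps by blast
    have eq: "(\<Union>l\<in>set w. even_support l (\<gamma> l)) =
        even_support l (\<gamma> l) \<union> (\<Union>l\<in>set ?w. even_support l (\<gamma> l))"
      using Cons by auto
    have "count (mset w) l = \<gamma> l" using less.prems Cons by simp
    then show ?thesis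
      unfolding even_gen_prod_split[of \<gamma> w l] eq
      using assms(1) by (simp only:) (intro nonzero_multiple_mult IH nonzero_multiple_even_gen_power;
        auto simp: even_support_def)
  qed
qed

lemma nonzero_multiple_odd_gen_prod:
  "distinct js \<Longrightarrow> nonzero_multiple (prod_list (map odd_gen js)) ((\<lambda>l. prod_encode (l, 0)) ` set js)"
proof (induction js)
  case Nil
  show ?case by (simp add: nonzero_multiple_one)
next
  case (Cons l js)
  have "nonzero_multiple (odd_gen l * prod_list (map odd_gen js) :: 'a grassmann)
      ({prod_encode (l, 0)} \<union> (\<lambda>l. prod_encode (l, 0)) ` set js)"
    using Cons unfolding odd_gen_def[of l]
    by (intro nonzero_multiple_mult nonzero_multiple_gbasis) auto
  then show ?case by simp
qed

text \<open>The pivot does not occur in \<open>js\<close>, so its whole multiplicity sits in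
  \<open>w\<close>: the derivative of \<open>w\<close> along the pivot has an invertible
  coefficient.\<close>

lemma std_pairs_pivot:
  assumes "(w, js) \<in> std_pairs p"
  shows "\<not> p dvd count (mset w) (pivot p (mset (w @ js)))"
proof -
  let ?i = "pivot p (mset (w @ js))"
  from assms obtain l where "\<not> p dvd count (mset (w @ js)) l" and i: "?i \<notin> set js"
    by (auto simp: std_pairs_def)
  then have "\<not> p dvd count (mset (w @ js)) ?i"
    unfolding pivot_def by (rule_tac LeastI)
  with i show ?thesis by (simp add: count_mset_0_iff[THEN iffD2])
qed

lemma subset_mset_size_eq: "A \<subseteq># B \<Longrightarrow> size B \<le> size A \<Longrightarrow> A = B"
  using mset_subset_size[of A B] by (auto simp: subset_mset.le_less)

text \<open>Injectivity of d on the standard span, in contrapositive form: a substitution is built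
  under which one chosen monomial of \<open>K\<close> has an odd component that no other monomial
  can cancel.\<close>

lemma std_mon_independent:
  fixes c :: "nat list \<times> nat list \<Rightarrow> 'k::field"
  assumes char: "CHAR('k) \<noteq> 2" and fin: "finite K" and K: "K \<subseteq> std_pairs (CHAR('k))"
    and c: "\<And>q. q \<in> K \<Longrightarrow> c q \<noteq> 0"
    and even: "\<And>y. (\<And>i. y i \<in> grass0) \<Longrightarrow> geven (gru.evalp y (\<Sum>q\<in>K. fscale (c q) (mon q)))"
  shows "K = {}"
proof (rule ccontr)
  assume "K \<noteq> {}"
  let ?p = "CHAR('k)"
  \<comment> \<open>Shortest commutator word before shortest word part: the first criterion limits
    the differentials of the competitors, the second then limits their even factors.\<close>
  obtain q0 where "q0 \<in> K"
    and min0: "\<And>q. (q, q0) \<in> measures [\<lambda>(w, js). length js, \<lambda>(w, js). length w] \<Longrightarrow> q \<notin> K"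
    by (rule wfE_min'[OF wf_measures[of "[\<lambda>(w, js). length js, \<lambda>(w, js). length w]"] \<open>K \<noteq> {}\<close>])
      (rule that)
  obtain w0 js0 where q0_eq: "q0 = (w0, js0)" by (cases q0)
  with \<open>q0 \<in> K\<close> have q0: "(w0, js0) \<in> K" by simp
  have min: "length js0 < length js \<or> length js0 = length js \<and> length w0 \<le> length w"
    if "(w, js) \<in> K" for w js
  proof -
    have "((w, js), q0) \<notin> measures [\<lambda>(w, js). length js, \<lambda>(w, js). length w]"
      using min0 that by blast
    then show ?thesis by (auto simp: q0_eq)
  qed
  have std0: "sorted w0" "sorted js0" "distinct js0" "even (length js0)"
    "?p > 0 \<longrightarrow> (\<forall>l. count (mset w0) l < ?p)"
    using q0 K by (auto simp: std_pairs_def)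
  define i where "i = pivot ?p (mset (w0 @ js0))"
  have i: "i \<notin> set js0" using q0 K by (auto simp: std_pairs_def i_def)
  have dvd_i: "\<not> ?p dvd count (mset w0) i"
    unfolding i_def using std_pairs_pivot q0 K by blast
  then have "i \<in> set w0"
    by (intro ccontr[of "i \<in> set w0"]) (simp add: count_mset_0_iff[THEN iffD2])
  \<comment> \<open>Only x(i) and the variables in js0 get an odd part, and a(l) is a sum of as many pairs as x(l)
    occurs in v. By minimality of q0, any other monomial of K takes a value with even terms only,
    or repeats an odd generator, or contains a vanishing power of some a(l).\<close>
  define v where "v = remove1 i w0"
  define L where "L = insert i (set js0)"
  define a :: "nat \<Rightarrow> 'k grassmann" where "a = (\<lambda>l. even_gen l (count (mset v) l))"
  define u :: "nat \<Rightarrow> 'k grassmann" where "u l = (if l \<in> L then odd_gen l else 0)" for l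
  define y where "y = (\<lambda>l. a l + u l)"
  have a: "geven (a l)" and u: "godd (u l)" for l
    by (simp_all add: a_def u_def geven_even_gen godd_odd_gen)
  have mw0: "mset w0 = add_mset i (mset v)" using \<open>i \<in> set w0\<close> by (simp add: v_def)

  \<comment> \<open>\<open>X\<close> is the term of d q0 that contains da(i), up to its coefficient;
    \<open>T\<close> collects all generators in it and has odd size.\<close>
  define X where "X = prod_list (map a v) * (u i * prod_list (map u js0))"
  define T where "T = (\<Union>l\<in>set v. even_support l (count (mset v) l)) \<union>
    ({prod_encode (i, 0)} \<union> (\<lambda>l. prod_encode (l, 0)) ` set js0)"
  have "nonzero_multiple X T"
  proof -
    have "?p > 0 \<longrightarrow> (\<forall>l. count (mset v) l < ?p)"
    proof (intro impI allI)
      fix l assume "?p > 0"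
      with std0(5) have "count (mset w0) l < ?p" by blast
      then show "count (mset v) l < ?p" by (simp add: mw0 split: if_splits)
    qed
    then have 1: "nonzero_multiple (prod_list (map a v)) (\<Union>l\<in>set v. even_support l (count (mset v) l))"
      unfolding a_def by (intro nonzero_multiple_even_gen_prod) auto
    have "map u js0 = map odd_gen js0" by (simp add: u_def L_def)
    then have 2: "nonzero_multiple (prod_list (map u js0)) ((\<lambda>l. prod_encode (l, 0)) ` set js0)"
      using nonzero_multiple_odd_gen_prod[OF std0(3)] by (simp only:)
    have 3: "nonzero_multiple (u i) {prod_encode (i, 0)}"
      by (simp add: u_def L_def odd_gen_def nonzero_multiple_gbasis)
    show ?thesis
      unfolding X_def T_def using i
      by (intro nonzero_multiple_mult 1 2 3) (auto simp: even_support_def)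
  qed
  then have XT: "gcoeff X T \<noteq> 0" by (rule nonzero_multiple_coeff)
  have "godd X"
    unfolding X_def using godd_prod_list[of u js0] std0(4) u
    by (intro geven_godd_mult[OF geven_prod_list] godd_geven_mult[OF u]) (auto simp: a)
  with XT have T: "odd (card T)" by (auto simp: godd_def)

  \<comment> \<open>The undifferentiated term is even and cannot reach the odd index set
    \<open>T\<close>; only the derivative along \<open>j\<close> contributes to this
    coefficient.\<close>
  have top: "gcoeff (gru.evalp y (mon (w, js))) T = 2 ^ (length js div 2) * (of_nat (count (mset w) j) *
      gcoeff (prod_list (map a (remove1 j w)) * (u j * prod_list (map u js))) T)"
    if js: "even (length js)" and kill: "\<And>l. l \<noteq> j \<Longrightarrow> u l * prod_list (map u js) = 0" for w js j
  proof -
    have "geven (prod_list (map a w) * prod_list (map u js))"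
      using godd_prod_list[of u js] js u by (intro geven_mult[OF geven_prod_list]) (auto simp: a)
    with T have "gcoeff (prod_list (map a w) * prod_list (map u js)) T = 0" by (simp add: geven_def)
    moreover have "prod_list (map y w) * prod_list (map u js) =
        prod_list (map a w) * prod_list (map u js) +
        gscale (of_nat (count (mset w) j))
          (prod_list (map a (remove1 j w)) * (u j * prod_list (map u js)))"
      unfolding y_def by (rule prod_list_decomp[OF char a u kill])
    moreover have "gru.evalp y (comm_word js) = gscale (2 ^ (length js div 2)) (prod_list (map u js))"
      unfolding y_def by (rule evalp_comm_word[OF char a u js])
    ultimately show ?thesis
      by (simp add: mon_def gru.evalp_mult gscale_mult gscale.rep_eq plus_grassmann.rep_eq)
  qed
  have zero: "gcoeff (gru.evalp y (mon (w, js))) T = 0"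
    if q: "(w, js) \<in> K" "(w, js) \<noteq> (w0, js0)" for w js
  proof -
    have std: "sorted w" "sorted js" "distinct js" "even (length js)"
      and pivot: "pivot ?p (mset (w @ js)) \<notin> set js"
      using q K by (auto simp: std_pairs_def)
    show ?thesis
    proof (cases "set js \<subseteq> L")
      case False
      then obtain l where l: "l \<in> set js" "l \<notin> L" by blast
      have "x \<in> set xs \<Longrightarrow> u x = 0 \<Longrightarrow> prod_list (map u xs) = 0" for x xs
        by (induction xs) auto
      with l have "prod_list (map u js) = 0" by (simp add: u_def)
      \<comment> \<open>The direction 0 is arbitrary, as the product of the odd parts is already
        0.\<close>
      then show ?thesis by (subst top[of _ 0]) (simp_all add: std gcoeff_simps)
    next
      case True
      have cards: "card L = Suc (length js0)" "card (set js) = length js"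
        using std0(3) i std(3) by (simp_all add: L_def distinct_card)
      \<comment> \<open>\<open>js\<close> fits into \<open>L\<close>, which has just one element
        more than \<open>js0\<close>; since both lengths are even and \<open>js0\<close> is
        shortest, they agree, and exactly one variable \<open>j\<close> of \<open>L\<close> is
        missing from \<open>js\<close>.\<close>
      have "length js \<le> Suc (length js0)" using card_mono[OF _ True] cards by (simp add: L_def)
      moreover have "length js0 \<le> length js" using min[OF q(1)] by auto
      ultimately have len: "length js = length js0"
        using std(4) std0(4) by (cases "length js = Suc (length js0)") auto
      then have "card (L - set js) = 1" using cards True by (simp add: card_Diff_subset)
      then obtain j where j: "L - set js = {j}" by (auto simp: card_1_singleton_iff)
      have kill: "u l * prod_list (map u js) = 0" if "l \<noteq> j" for l
      proof (cases "l \<in> L")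
        case True
        with that j have "l \<in> set js" by blast
        then show ?thesis by (intro godd_mult_prod_list_zero char u)
      qed (simp add: u_def)
      have "of_nat (count (mset w) j) = (0 :: 'k) \<or> prod_list (map a (remove1 j w)) = 0"
      proof (rule ccontr)
        assume nz: "\<not> ?thesis"
        then have "j \<in> set w"
          by (intro ccontr[of "j \<in> set w"]) (simp add: count_mset_0_iff[THEN iffD2])
        then have mw: "mset w = add_mset j (mset (remove1 j w))" by simp
        have "mset (remove1 j w) \<subseteq># mset v"
        proof (rule mset_subset_eqI, rule ccontr)
          fix l assume "\<not> count (mset (remove1 j w)) l \<le> count (mset v) l"
          then have "prod_list (map a (remove1 j w)) = 0"
            unfolding a_def by (intro even_gen_prod_zero[of "count (mset v)" l]) (simp only: not_le)
          with nz show False by simp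
        qed
        \<comment> \<open>Nilpotency bounds every exponent by that in \<open>v\<close>, and
          minimality of \<open>w0\<close> forbids a smaller total degree, so nothing but equality is
          left.\<close>
        moreover have "size (mset v) \<le> size (mset (remove1 j w))"
          using min[OF q(1)] len arg_cong[OF mw0, of size] arg_cong[OF mw, of size]
          unfolding size_add_mset size_mset by linarith
        ultimately have eq: "mset (remove1 j w) = mset v"
          by (rule subset_mset_size_eq)
        have mw': "mset w = add_mset j (mset v)" using mw unfolding eq .
        \<comment> \<open>Adding \<open>i\<close> to \<open>js0\<close> or \<open>j\<close> to
          \<open>js\<close> gives the same set \<open>L\<close>, so both monomials have the same
          multidegree and hence the same pivot \<open>i\<close>. As a normal form, \<open>js\<close>
          omits it, which forces \<open>j = i\<close>.\<close>
        have "mset_set L = add_mset i (mset js0)"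
          using i std0(3) by (simp add: L_def mset_set_set)
        moreover have "L = insert j (set js)" "j \<notin> set js" using j True by auto
        then have "mset_set L = add_mset j (mset js)" using std(3) by (simp add: mset_set_set)
        ultimately have "mset (w @ js) = mset (w0 @ js0)" by (simp add: mw' mw0)
        with pivot have "i \<notin> set js" by (simp add: i_def)
        then have "i = j" using j by (auto simp: L_def)
        with mw' mw0 have "mset w = mset w0" by (simp only:)
        then have "w = w0" using std(1) std0(1)
          using properties_for_sort[of w0 w] properties_for_sort[of w w] by simp
        moreover have "set js = set js0" using j \<open>i = j\<close> i True by (auto simp: L_def)
        then have "js = js0" by (intro sorted_distinct_set_unique std(2,3) std0(2,3))
        ultimately show False using q(2) by simp
      qed
      then show ?thesis
        using top[where w = w, OF std(4) kill] by (elim disjE) (simp_all add: zero_grassmann.rep_eq)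
    qed
  qed
  have nonzero: "gcoeff (gru.evalp y (mon (w0, js0))) T \<noteq> 0"
  proof -
    have kill: "u l * prod_list (map u js0) = 0" if "l \<noteq> i" for l
    proof (cases "l \<in> L")
      case True
      with that show ?thesis by (intro godd_mult_prod_list_zero char u) (simp add: L_def)
    qed (simp add: u_def)
    have "of_nat (count (mset w0) i) \<noteq> (0 :: 'k)"
      using dvd_i by (simp only: of_nat_eq_0_iff_char_dvd not_False_eq_True)
    then show ?thesis
      using top[where w = w0, OF std0(4) kill] XT two_neq_zero[OF char] by (simp add: X_def v_def)
  qed
  have "gcoeff (gru.evalp y (\<Sum>q\<in>K. fscale (c q) (mon q))) T =
      (\<Sum>q\<in>K. c q * gcoeff (gru.evalp y (mon q)) T)"
    by (simp add: gru.evalp_sum gru.evalp_scale gcoeff_sum gscale.rep_eq)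
  also have "\<dots> = (\<Sum>q\<in>K. if q = (w0, js0) then c q * gcoeff (gru.evalp y (mon q)) T else 0)"
  proof (intro sum.cong refl)
    fix q assume "q \<in> K"
    then show "c q * gcoeff (gru.evalp y (mon q)) T =
        (if q = (w0, js0) then c q * gcoeff (gru.evalp y (mon q)) T else 0)"
      using zero[of "fst q" "snd q"] by simp
  qed
  also have "\<dots> \<noteq> 0"
    using fin q0 c nonzero by simp
  finally have "gcoeff (gru.evalp y (\<Sum>q\<in>K. fscale (c q) (mon q))) T \<noteq> 0" .
  moreover have "y l \<in> grass0" for l
    by (simp add: grass0_eq y_def a_def u_def even_gen_def odd_gen_def gcoeff_simps gcoeff_sum)
  then have "geven (gru.evalp y (\<Sum>q\<in>K. fscale (c q) (mon q)))" by (rule even)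
  ultimately show False using T by (simp add: geven_def)
qed

section \<open>The T-space of polynomials with central values, identities included\<close>

definition central_polys :: "'k::field free_alg set" where
  "central_polys = {f \<in> free0. \<forall>\<phi>. alg_hom_on fscale free0 gscale grass0 \<phi> \<longrightarrow> \<phi> f \<in> grass0_centre}"

lemma T_space_central_polys:
  assumes "CHAR('k::field) \<noteq> 2"
  shows "T_space (central_polys :: 'k free_alg set)"
  unfolding T_space_def
proof (intro conjI allI impI)
  show "central_polys \<subseteq> (free0 :: 'k free_alg set)" by (auto simp: central_polys_def)
  have closed: "0 \<in> (grass0_centre :: 'k grassmann set)"
    "x \<in> grass0_centre \<Longrightarrow> z \<in> grass0_centre \<Longrightarrow> x + z \<in> grass0_centre"
    "x \<in> grass0_centre \<Longrightarrow> gscale c x \<in> grass0_centre" for x z :: "'k grassmann" and c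
    using gr.subspace_0[OF grass0_subspace] gr.subspace_add[OF grass0_subspace]
      gr.subspace_scale[OF grass0_subspace]
    by (auto simp: grass0_centre_eq[OF assms])
  have zero: "\<phi> 0 = 0" if "alg_hom_on fscale free0 gscale grass0 \<phi>"
    for \<phi> :: "'k free_alg \<Rightarrow> 'k grassmann"
  proof -
    have "\<phi> (fscale 0 0) = gscale 0 (\<phi> 0)"
      using that fa.subspace_0[OF subspace_free0] unfolding alg_hom_on_def by blast
    then show ?thesis by simp
  qed
  show "fa.subspace (central_polys :: 'k free_alg set)"
    unfolding fa.subspace_def
  proof (intro conjI allI ballI)
    show "0 \<in> (central_polys :: 'k free_alg set)"
      by (auto simp: central_polys_def fa.subspace_0[OF subspace_free0] zero closed)
    fix f g :: "'k free_alg" and c :: 'k assume f: "f \<in> central_polys"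
    show "fscale c f \<in> central_polys"
      using f by (auto simp: central_polys_def fa.subspace_scale[OF subspace_free0] alg_hom_on_def closed)
    assume g: "g \<in> central_polys"
    show "f + g \<in> central_polys"
      using f g by (auto simp: central_polys_def fa.subspace_add[OF subspace_free0] alg_hom_on_def closed)
  qed
  fix \<psi> :: "'k free_alg \<Rightarrow> 'k free_alg"
  assume psi: "alg_hom_on fscale free0 fscale free0 \<psi>"
  show "\<psi> ` central_polys \<subseteq> central_polys"
  proof (rule image_subsetI)
    fix f :: "'k free_alg" assume f: "f \<in> central_polys"
    then have "\<psi> f \<in> free0" using psi by (simp add: central_polys_def alg_hom_on_def)
    moreover have "\<phi> (\<psi> f) \<in> grass0_centre" if "alg_hom_on fscale free0 gscale grass0 \<phi>" for \<phi>
      using f alg_hom_on_compose[OF psi that] unfolding central_polys_def by blast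
    ultimately show "\<psi> f \<in> central_polys" by (simp add: central_polys_def)
  qed
qed

lemma alg_hom_on_free0:
  assumes "alg_hom_on fscale free0 sc B \<phi>"
  shows "f \<in> free0 \<Longrightarrow> \<phi> f \<in> B"
    and "f \<in> free0 \<Longrightarrow> g \<in> free0 \<Longrightarrow> \<phi> (f + g) = \<phi> f + \<phi> g"
    and "f \<in> free0 \<Longrightarrow> g \<in> free0 \<Longrightarrow> \<phi> (f * g) = \<phi> f * \<phi> g"
    and "f \<in> free0 \<Longrightarrow> \<phi> (fscale c f) = sc c (\<phi> f)"
  using assms by (auto simp: alg_hom_on_def)

text \<open>\<open>alg_hom_on\<close> mentions sums, products and scalars only, so the difference is
  written with the scalar -1.\<close>

lemma hom_comm:
  assumes hom: "alg_hom_on fscale free0 gscale grass0 \<phi>" and f: "f \<in> free0" and g: "g \<in> free0"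
  shows "\<phi> (comm f g) = comm (\<phi> f) (\<phi> g)"
proof -
  have eq: "comm f g = f * g + fscale (-1) (g * f)"
    by (rule poly_mapping_eqI) (simp add: comm_def lookup_add lookup_minus)
  have in_free0: "f * g \<in> free0" "g * f \<in> free0" by (intro free0_mult_left f g)+
  have "fscale (-1) (g * f) \<in> free0"
    by (intro fa.subspace_scale subspace_free0 in_free0)
  then have "\<phi> (comm f g) = \<phi> f * \<phi> g + gscale (-1) (\<phi> g * \<phi> f)"
    unfolding eq by (simp only: alg_hom_on_free0(2-4)[OF hom] in_free0 f g)
  then show ?thesis by (simp add: comm_def)
qed

text \<open>A homomorphism on \<open>free0\<close> says nothing about the unit; hence nonempty lists
  here and positive exponents for powers.\<close>

lemma hom_prod_list:
  assumes hom: "alg_hom_on fscale free0 gscale grass0 \<phi>" and fs: "fs \<noteq> []" "set fs \<subseteq> free0"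
  shows "prod_list fs \<in> free0 \<and> \<phi> (prod_list fs) = prod_list (map \<phi> fs)"
  using fs
proof (induction fs)
  case (Cons f fs)
  then show ?case
    using alg_hom_on_free0(3)[OF hom] by (cases "fs = []") (simp_all add: free0_mult_right)
qed simp

lemma hom_power:
  assumes hom: "alg_hom_on fscale free0 gscale grass0 \<phi>" and "f \<in> free0" "n > 0"
  shows "f ^ n \<in> free0 \<and> \<phi> (f ^ n) = \<phi> f ^ n"
  using hom_prod_list[OF hom, of "replicate n f"] assms(2,3) by simp

lemma alg_hom_on_egen: "alg_hom_on fscale free0 gscale grass0 (gru.evalp egen)"
  by (intro gru.alg_hom_on_evalp grass0_subspace grass0_mult)
     (simp_all add: grass0_eq egen_def gcoeff_simps)

lemma central_polysI:
  assumes char: "CHAR('k::field) \<noteq> 2" and f: "f \<in> free0"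
    and even: "\<And>\<phi>. alg_hom_on fscale free0 gscale grass0 \<phi> \<Longrightarrow> geven (\<phi> f)"
  shows "f \<in> (central_polys :: 'k free_alg set)"
  using f even alg_hom_on_free0(1)[OF _ f]
  by (auto simp: central_polys_def grass0_centre_eq[OF char])

lemma comm_in_central_polys:
  assumes char: "CHAR('k::field) \<noteq> 2"
  shows "comm (var i) (var j) \<in> (central_polys :: 'k free_alg set)"
  by (rule central_polysI[OF char]) (simp_all add: hom_comm geven_comm)

text \<open>An identity is the difference of two central polynomials that are not identities.\<close>

lemma CP_grass0_eq:
  assumes char: "CHAR('k::field) \<noteq> 2"
  shows "CP_grass0 = (central_polys :: 'k free_alg set)"
proof
  have sub: "grass0_central_polys \<subseteq> (central_polys :: 'k free_alg set)"
    by (auto simp: grass0_central_polys_def central_polys_def)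
  then show "CP_grass0 \<subseteq> (central_polys :: 'k free_alg set)"
    unfolding CP_grass0_def T_span_def by (rule hull_minimal) (rule T_space_central_polys[OF char])
  \<comment> \<open>One fixed evaluation is enough as a witness: at the generators,
    \<open>?c\<close> takes the nonzero value 2 e_0 e_1.\<close>
  let ?c = "comm (var 0) (var 1) :: 'k free_alg" and ?\<phi> = "gru.evalp egen :: 'k free_alg \<Rightarrow> _"
  have T: "T_space (CP_grass0 :: 'k free_alg set)"
    unfolding CP_grass0_def by (intro T_space_T_span) (auto simp: grass0_central_polys_def)
  have base: "f \<in> CP_grass0" if "f \<in> central_polys" "?\<phi> f \<noteq> 0" for f :: "'k free_alg"
    unfolding CP_grass0_def T_span_def
    by (rule hull_inc)
      (use that alg_hom_on_egen in \<open>auto simp: grass0_central_polys_def central_polys_def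
        grass0_identities_def\<close>)
  have c: "?c \<in> central_polys" by (rule comm_in_central_polys[OF char])
  have "?\<phi> ?c = comm (0 + egen 0) (0 + egen 1)"
    by (simp add: gru.evalp_comm)
  also have "\<dots> = gscale 2 (egen 0 * egen 1)"
    unfolding egen_def by (intro comm_decomp geven_simps godd_gbasis) simp_all
  finally have "nonzero_multiple (?\<phi> ?c) ({0} \<union> {1})"
    using two_neq_zero[OF char] unfolding egen_def
    by (simp only:) (intro nonzero_multiple_scale nonzero_multiple_mult nonzero_multiple_gbasis; simp)
  then have c_nz: "?\<phi> ?c \<noteq> 0"
    using nonzero_multiple_coeff by (fastforce simp: zero_grassmann.rep_eq)
  show "central_polys \<subseteq> (CP_grass0 :: 'k free_alg set)"
  proof
    fix f :: "'k free_alg" assume f: "f \<in> central_polys"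
    show "f \<in> CP_grass0"
    \<comment> \<open>Vanishing at this single evaluation already suffices: then
      \<open>f + ?c\<close> and \<open>?c\<close> both have nonzero value there, and
      \<open>f\<close> is their difference.\<close>
    proof (cases "?\<phi> f = 0")
      case True
      have sp: "fa.subspace (central_polys :: 'k free_alg set)"
        using T_space_central_polys[OF char] by (simp add: T_space_def)
      have "f + ?c \<in> CP_grass0"
        using fa.subspace_add[OF sp f c] c_nz by (intro base) (simp_all add: gru.evalp_add True)
      moreover have "?c \<in> CP_grass0" using c c_nz by (rule base)
      moreover have "fa.subspace (CP_grass0 :: 'k free_alg set)" using T by (simp add: T_space_def)
      ultimately have "(f + ?c) - ?c \<in> CP_grass0" by (intro fa.subspace_diff)
      then show ?thesis by simp
    qed (simp add: base f)
  qed
qed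

text \<open>Split \<open>f\<close> into a standard part and an element of \<open>S\<close>. The
  standard part again has central values, so by independence it is 0.\<close>

lemma (in central_T_space) central_polys_subset:
  assumes "S \<subseteq> central_polys"
  shows "central_polys \<subseteq> S"
proof
  let ?std = "std_pairs (CHAR('k))"
  have sp: "fa.subspace (central_polys :: 'k free_alg set)"
    using T_space_central_polys[OF char] by (simp add: T_space_def)
  fix f :: "'k free_alg" assume f: "f \<in> central_polys"
  then have "f \<in> std_span" using free0_subset_std_span by (auto simp: central_polys_def)
  then obtain g s where fgs: "f = g + s" and g: "g \<in> fa.span (mon ` ?std)" and "s \<in> fa.span S"
    unfolding std_span_def fa.span_Un by blast
  then have s: "s \<in> S" using fa.span_eq_iff[of S] subspace_S by blast
  have gc: "g \<in> central_polys"
    using fa.subspace_diff[OF sp f, of s] s assms by (auto simp: fgs)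
  obtain t r where t: "finite t" "t \<subseteq> mon ` ?std" and gt: "g = (\<Sum>m\<in>t. fscale (r m) m)"
    using g unfolding fa.span_explicit by blast
  \<comment> \<open>One preimage is chosen for each monomial with nonzero coefficient, which turns
    the sum over monomials into a sum over pairs.\<close>
  define K where "K = inv_into ?std mon ` {m \<in> t. r m \<noteq> 0}"
  have inv: "mon (inv_into ?std mon m) = m" "inv_into ?std mon m \<in> ?std" if "m \<in> t" for m
    using that t(2) by (auto intro: f_inv_into_f inv_into_into)
  have inj: "inj_on (inv_into ?std mon) {m \<in> t. r m \<noteq> 0}"
    using t(2) by (intro inj_on_inv_into) auto
  have "(\<Sum>q\<in>K. fscale (r (mon q)) (mon q)) = (\<Sum>m\<in>{m \<in> t. r m \<noteq> 0}. fscale (r m) m)"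
    unfolding K_def by (simp add: sum.reindex[OF inj] inv(1))
  also have "\<dots> = g" unfolding gt using t(1) by (intro sum.mono_neutral_left) auto
  finally have gK: "g = (\<Sum>q\<in>K. fscale (r (mon q)) (mon q))" ..
  have "K = {}"
  proof (rule std_mon_independent[OF char, where c = "\<lambda>q. r (mon q)"])
    show "finite K" "K \<subseteq> ?std" using t(1) inv(2) by (auto simp: K_def)
    show "r (mon q) \<noteq> 0" if "q \<in> K" for q using that by (auto simp: K_def inv(1))
    fix y :: "nat \<Rightarrow> 'k grassmann" assume "\<And>i. y i \<in> grass0"
    then have "alg_hom_on fscale free0 gscale grass0 (gru.evalp y)"
      by (intro gru.alg_hom_on_evalp grass0_subspace grass0_mult)
    with gc have "gru.evalp y g \<in> grass0_centre" by (simp add: central_polys_def)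
    then show "geven (gru.evalp y (\<Sum>q\<in>K. fscale (r (mon q)) (mon q)))"
      by (simp add: grass0_centre_eq[OF char] flip: gK)
  qed
  with s show "f \<in> S" by (simp add: fgs gK)
qed

section \<open>The right-hand side as a T-space of polynomials with central values\<close>

lemma T_space_set_plus:
  assumes A: "T_space A" and B: "T_space B"
  shows "T_space (A + B)"
  unfolding T_space_def
proof (intro conjI allI impI)
  have sub: "A \<subseteq> free0" "B \<subseteq> free0" using A B by (simp_all add: T_space_def)
  then show "A + B \<subseteq> free0"
    by (auto simp: set_plus_def intro!: fa.subspace_add[OF subspace_free0])
  show "fa.subspace (A + B)"
  proof -
    have "A + B = {x + y |x y. x \<in> A \<and> y \<in> B}" by (auto simp: set_plus_def)
    then show ?thesis using A B fa.subspace_sums[of A B] by (simp add: T_space_def)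
  qed
  fix \<phi> :: "'a free_alg \<Rightarrow> 'a free_alg" assume hom: "alg_hom_on fscale free0 fscale free0 \<phi>"
  then have "\<phi> ` A \<subseteq> A" "\<phi> ` B \<subseteq> B" using A B by (simp_all add: T_space_def)
  then have "\<phi> a + \<phi> b \<in> A + B" if "a \<in> A" "b \<in> B" for a b
    using that by (intro set_plus_intro) auto
  moreover have "\<phi> (a + b) = \<phi> a + \<phi> b" if "a \<in> A" "b \<in> B" for a b
    using that sub by (intro alg_hom_on_free0(2)[OF hom]) auto
  ultimately show "\<phi> ` (A + B) \<subseteq> A + B"
    by (auto elim!: set_plus_elim)
qed

lemma subset_T_span: "Y \<subseteq> T_span Y"
  by (simp add: T_span_def hull_subset)

lemma T_span_subset: "Y \<subseteq> V \<Longrightarrow> T_space V \<Longrightarrow> T_span Y \<subseteq> V"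
  by (simp add: T_span_def hull_minimal)

lemma comm2_in_central_polys:
  assumes char: "CHAR('k::field) \<noteq> 2"
  shows "comm (var i) (var j) * comm (var l) (var m) \<in> (central_polys :: 'k free_alg set)"
  by (rule central_polysI[OF char])
    (simp_all add: free0_mult_left alg_hom_on_free0(3) hom_comm geven_comm geven_mult)

text \<open>Both polynomials are identities: p-th powers vanish on \<open>grass0\<close>.\<close>

lemma power_in_central_polys:
  assumes char: "CHAR('k::field) > 2"
  shows "var i ^ CHAR('k) \<in> (central_polys :: 'k free_alg set)"
    and "var j * var i ^ CHAR('k) \<in> (central_polys :: 'k free_alg set)"
proof -
  have 0: "var i ^ CHAR('k) \<in> (free0 :: 'k free_alg set)" "\<phi> (var i ^ CHAR('k)) = 0"
    if hom: "alg_hom_on fscale free0 gscale grass0 \<phi>" for \<phi> :: "'k free_alg \<Rightarrow> _"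
    using hom_power[OF hom, of "var i" "CHAR('k)"] char alg_hom_on_free0(1)[OF hom, of "var i"]
    by (simp_all add: grass0_power_char)
  note free = 0(1)[OF alg_hom_on_egen]
  have char': "CHAR('k) \<noteq> 2" using char by simp
  show "var i ^ CHAR('k) \<in> (central_polys :: 'k free_alg set)"
    by (rule central_polysI[OF char' free]) (simp only: 0(2) geven_simps)
  show "var j * var i ^ CHAR('k) \<in> (central_polys :: 'k free_alg set)"
    by (rule central_polysI[OF char' free0_mult_left[OF free]])
      (simp only: alg_hom_on_free0(3) 0(2) free var_in_free0 mult_zero_right geven_simps)
qed

text \<open>Each factor has even values by \<open>geven_comm_power\<close>, and even elements are
  closed under products.\<close>

lemma w_poly_in_central_polys:
  assumes char: "CHAR('k::field) > 2" and n: "n \<ge> 1"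
  shows "w_poly (CHAR('k)) n \<in> (central_polys :: 'k free_alg set)"
proof -
  let ?m = "CHAR('k) - 1"
  define F :: "nat \<Rightarrow> 'k free_alg" where
    "F = (\<lambda>k. comm (var (2*k-1)) (var (2*k)) * var (2*k-1) ^ ?m * var (2*k) ^ ?m)"
  have F: "F k \<in> free0" for k
    unfolding F_def by (intro free0_mult_right comm_var_in_free0)
  have even: "geven (\<phi> (F k))" if hom: "alg_hom_on fscale free0 gscale grass0 \<phi>" for \<phi> k
    using hom_power[OF hom, of "var _" ?m] char
    by (simp add: F_def alg_hom_on_free0(3)[OF hom] free0_mult_right hom_comm[OF hom] geven_comm_power)
  have w: "w_poly (CHAR('k)) n = prod_list (map F [1..<n+1])"
    by (simp only: w_poly_def F_def)
  have "map F [1..<n+1] \<noteq> []" "set (map F [1..<n+1]) \<subseteq> free0" using n F by auto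
  note prod = hom_prod_list[OF _ this]
  show ?thesis
  proof (rule central_polysI)
    show "w_poly (CHAR('k)) n \<in> (free0 :: 'k free_alg set)"
      unfolding w using prod[OF alg_hom_on_egen] by blast
    fix \<phi> :: "'k free_alg \<Rightarrow> 'k grassmann" assume hom: "alg_hom_on fscale free0 gscale grass0 \<phi>"
    show "geven (\<phi> (w_poly (CHAR('k)) n))"
      unfolding w prod[OF hom, THEN conjunct2] by (intro geven_prod_list) (auto simp: even[OF hom])
  qed (use char in simp)
qed

theorem corollary2p3:
  shows "(CHAR('k::field) = 0 \<longrightarrow>
            (CP_grass0 :: 'k free_alg set) =
              T_span {comm (var 1) (var 2), comm (var 1) (var 2) * comm (var 3) (var 4)}) \<and>
         (\<forall>p. CHAR('k) = p \<and> p > 2 \<longrightarrow>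
            (CP_grass0 :: 'k free_alg set) =
              T_span {comm (var 1) (var 2), var 1 ^ p, var 2 * var 1 ^ p,
                 comm (var 1) (var 2) * comm (var 3) (var 4)}
              + T_span {w_poly p n | n. n \<ge> 1})"
proof (intro conjI impI allI, goal_cases)
  case 1
  let ?Y = "{comm (var 1) (var 2), comm (var 1) (var 2) * comm (var 3) (var 4)} :: 'k free_alg set"
  have char: "CHAR('k) \<noteq> 2" using 1 by simp
  have Y: "?Y \<subseteq> central_polys"
    using comm_in_central_polys[OF char] comm2_in_central_polys[OF char] by blast
  then have T: "T_space (T_span ?Y)" by (intro T_space_T_span) (auto simp: central_polys_def)
  interpret central_T_space "T_span ?Y"
    by unfold_locales (use T char 1 subset_T_span[of ?Y] in auto)
  have "T_span ?Y \<subseteq> central_polys" by (intro T_span_subset Y T_space_central_polys char)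
  then show ?case
    unfolding CP_grass0_eq[OF char] by (intro equalityI central_polys_subset)
next
  case (2 p)
  then have p: "p = CHAR('k)" "CHAR('k) > 2" and char: "CHAR('k) \<noteq> 2" by auto
  let ?Y = "{comm (var 1) (var 2), var 1 ^ p, var 2 * var 1 ^ p,
    comm (var 1) (var 2) * comm (var 3) (var 4)} :: 'k free_alg set"
  let ?W = "{w_poly p n | n. n \<ge> 1} :: 'k free_alg set"
  have Y: "?Y \<subseteq> central_polys"
    using comm_in_central_polys[OF char] comm2_in_central_polys[OF char]
      power_in_central_polys[OF p(2)] unfolding p(1) by blast
  have W: "?W \<subseteq> central_polys" using w_poly_in_central_polys[OF p(2)] unfolding p(1) by blast
  have TY: "T_space (T_span ?Y)" and TW: "T_space (T_span ?W)"
    using Y W by (intro T_space_T_span; auto simp: central_polys_def)+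
  have "0 \<in> T_span ?Y" "0 \<in> T_span ?W"
    using TY TW by (auto simp: T_space_def fa.subspace_0)
  then have sub: "T_span ?Y \<subseteq> T_span ?Y + T_span ?W" "T_span ?W \<subseteq> T_span ?Y + T_span ?W"
    by (force simp: set_plus_def)+
  have gens: "?Y \<subseteq> T_span ?Y + T_span ?W" "?W \<subseteq> T_span ?Y + T_span ?W"
    using sub subset_T_span[of ?Y] subset_T_span[of ?W] by blast+
  interpret central_T_space "T_span ?Y + T_span ?W"
    by unfold_locales (use T_space_set_plus[OF TY TW] char gens in \<open>auto simp flip: p(1)\<close>)
  have sp: "fa.subspace (central_polys :: 'k free_alg set)"
    using T_space_central_polys[OF char] by (simp add: T_space_def)
  have "T_span ?Y \<subseteq> central_polys" "T_span ?W \<subseteq> central_polys"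
    by (intro T_span_subset Y W T_space_central_polys char)+
  then have "T_span ?Y + T_span ?W \<subseteq> central_polys"
    by (auto simp: set_plus_def intro!: fa.subspace_add[OF sp])
  then show ?case
    unfolding CP_grass0_eq[OF char] by (intro equalityI central_polys_subset)
qed

end
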